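(* Let $L=I_d-A_1x_1-\cdots-A_gx_g$, $A_j\in M_d(\Bbbk)$, be an irreducible monic pencil. Then there exists $n_0\in\mathbb{N}$ such that $\det L(\Omega^{(n)}_1,\dots,\Omega^{(n)}_g)$ is an irreducible polynomial (in the $gn^2$ commuting entries of the generic matrices) for all $n\ge n_0$.
   Context: $\Bbbk$ is an algebraically closed field of characteristic $0$. A monic linear pencil $L=I_d-\sum_{j=1}^g A_jx_j$ with $A_j\in M_d(\Bbbk)$ is evaluated at a tuple $X$ of $n\times n$ matrices (over $\Bbbk$ or over a commutative $\Bbbk$-algebra) by $L(X)=I_{dn}-\sum_{j=1}^g A_j\otimes X_j$, with $\otimes$ the Kronecker product. $L$ is irreducible if $A_1,\dots,A_g$ generate $M_d(\Bbbk)$ as a $\Bbbk$-algebra (generated without adjoining the unit; this only matters for $d=1$, where it means that not all $A_j$ are $0$). $\Omega^{(n)}_1,\dots,\Omega^{(n)}_g$ are $n\times n$ generic matrices: their $gn^2$ entries are independent commuting variables over $\Bbbk$. *)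

theory Defs
  imports
    "HOL-Library.Poly_Mapping"
    "HOL-Computational_Algebra.Polynomial"
    "Jordan_Normal_Form.Determinant"
begin

(* The subalgebra of the d x d matrices generated by S without adjoining the identity;
   the rule "zero" only matters for empty S. *)
inductive_set mat_algebra_gen :: "nat \<Rightarrow> 'k :: field mat set \<Rightarrow> 'k mat set"
  for d :: nat and S :: "'k mat set" where
  gen: "A \<in> S \<Longrightarrow> A \<in> mat_algebra_gen d S"
| zero: "0\<^sub>m d d \<in> mat_algebra_gen d S"
| add: "A \<in> mat_algebra_gen d S \<Longrightarrow> B \<in> mat_algebra_gen d S \<Longrightarrow> A + B \<in> mat_algebra_gen d S"
| smult: "A \<in> mat_algebra_gen d S \<Longrightarrow> c \<cdot>\<^sub>m A \<in> mat_algebra_gen d S"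
| mult: "A \<in> mat_algebra_gen d S \<Longrightarrow> B \<in> mat_algebra_gen d S \<Longrightarrow> A * B \<in> mat_algebra_gen d S"

(* The monic pencil I - A_0 x_0 - ... - A_(g-1) x_(g-1) of size d is given by d, g and
   A :: nat => 'k mat; the values A j with j >= g are irrelevant. *)
definition irreducible_pencil :: "nat \<Rightarrow> nat \<Rightarrow> (nat \<Rightarrow> 'k :: field mat) \<Rightarrow> bool" where
  "irreducible_pencil d g A \<longleftrightarrow> mat_algebra_gen d (A ` {..<g}) = carrier_mat d d"

definition kronecker :: "'a :: semiring_1 mat \<Rightarrow> 'a mat \<Rightarrow> 'a mat" where
  "kronecker A B = mat (dim_row A * dim_row B) (dim_col A * dim_col B)
     (\<lambda>(r, c). A $$ (r div dim_row B, c div dim_col B) * B $$ (r mod dim_row B, c mod dim_col B))"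

(* h is the structure map of the commutative algebra that contains the entries of the
   n x n matrices X j. The sum of matrices is taken entrywise because matrices of
   unspecified dimension do not form an additive monoid. *)
definition pencil_eval ::
  "('k \<Rightarrow> 'a) \<Rightarrow> nat \<Rightarrow> nat \<Rightarrow> (nat \<Rightarrow> 'k mat) \<Rightarrow> nat \<Rightarrow> (nat \<Rightarrow> 'a :: comm_ring_1 mat) \<Rightarrow> 'a mat" where
  "pencil_eval h d g A n X =
     1\<^sub>m (d * n) - mat (d * n) (d * n) (\<lambda>rc. \<Sum>j<g. kronecker (map_mat h (A j)) (X j) $$ rc)"

(* Polynomials over 'k in the commuting variables (j, r, c), for all natural numbers j, r, c.
   For given g and n only those with j < g and r, c < n occur in the generic matrices; since
   'k is a field, every factor of a nonzero polynomial only involves variables of that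
   polynomial, so irreducibility is the same as in the ring of the g n^2 entries. *)
type_synonym 'k gpoly = "(nat \<times> nat \<times> nat \<Rightarrow>\<^sub>0 nat) \<Rightarrow>\<^sub>0 'k"

definition gconst :: "'k :: field \<Rightarrow> 'k gpoly" where
  "gconst a = Poly_Mapping.single 0 a"

definition gvar :: "nat \<times> nat \<times> nat \<Rightarrow> 'k :: field gpoly" where
  "gvar v = Poly_Mapping.single (Poly_Mapping.single v 1) 1"

definition generic_mat :: "nat \<Rightarrow> nat \<Rightarrow> 'k :: field gpoly mat" where
  "generic_mat n j = mat n n (\<lambda>(r, c). gvar (j, r, c))"

end

theory Submission
  imports Defs "HOL-Library.Product_Lexorder" "HOL-Library.Nat_Bijection"
begin

text \<open>
  Write \<open>f_n\<close> for the determinant of the pencil at generic \<open>n \<times> n\<close> matrices and regard the entry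
  indices \<open>r, c < n\<close> as nodes, so that a tuple of matrices is a graph with edges labelled by
  elements of the span of the \<open>A j\<close>.  A node \<open>h\<close> without loop can be eliminated from the
  determinant: this adds to the label of each edge \<open>(r, c)\<close> the product of the labels of \<open>(r, h)\<close>
  and \<open>(h, c)\<close>.  Hence a bounded number \<open>C\<close> of extra nodes suffices to give the edges
  between two chosen nodes \<open>i, l\<close> arbitrary labels from the algebra generated by the
  \<open>A j\<close>, that is, to put a generic matrix at the block of \<open>i, l\<close>.

  Let \<open>f_n = a b\<close>, let \<open>G\<close> be a set of \<open>C\<close> nodes, and \<open>V\<close> its complement.  A determinant with a generic
  block is linear in each row and column of the block, so one of \<open>a, b\<close> does not involve
  the block; comparing weighted degrees, this factor, restricted to \<open>V\<close>, does not involve the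
  nodes \<open>i, l\<close> either.  Varying \<open>i, l\<close>, one of \<open>a, b\<close> is constant on \<open>V\<close>, and it is the same
  factor, say \<open>b\<close>, for every \<open>G\<close>.  Then \<open>deg a \<ge> deg f_(n - C)\<close>, so \<open>deg b \<le> deg f_n - deg f_(n - C)\<close>,
  which is at most \<open>(n - C) / 2\<close> for large \<open>n\<close> because \<open>n \<mapsto> deg f_n\<close> is superadditive and at most \<open>d n\<close>.
  So each monomial of \<open>b\<close> involves at most \<open>n - C\<close> nodes, avoids some \<open>G\<close>, and is constant.
\<close>

section \<open>Substitutions and weighted degrees\<close>

abbreviation keys :: "('a \<Rightarrow>\<^sub>0 'b::zero) \<Rightarrow> 'a set" where "keys \<equiv> Poly_Mapping.keys"

abbreviation lookup :: "('a \<Rightarrow>\<^sub>0 'b::zero) \<Rightarrow> 'a \<Rightarrow> 'b" where "lookup \<equiv> Poly_Mapping.lookup"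

type_synonym gindex = "nat \<times> nat \<times> nat"

lemma gpoly_decompose:
  fixes p :: "'k::field gpoly"
  shows "p = (\<Sum>m\<in>keys p. Poly_Mapping.single m (lookup p m))"
proof (rule poly_mapping_eqI)
  fix m
  have "lookup (\<Sum>m\<in>keys p. Poly_Mapping.single m (lookup p m)) m
      = (\<Sum>m'\<in>keys p. if m' = m then lookup p m' else 0)"
    unfolding lookup_sum by (intro sum.cong) (auto simp: lookup_single when_def)
  also have "\<dots> = lookup p m"
    by (auto simp: sum.delta in_keys_iff)
  finally show "lookup p m = lookup (\<Sum>m\<in>keys p. Poly_Mapping.single m (lookup p m)) m" ..
qed

lemma gpoly_induct [case_names single add]:
  fixes p :: "'k::field gpoly"
  assumes single: "\<And>m c. P (Poly_Mapping.single m c)"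
    and add: "\<And>p q. P p \<Longrightarrow> P q \<Longrightarrow> P (p + q)"
  shows "P p"
proof -
  have "P (\<Sum>m\<in>S. Poly_Mapping.single m (lookup p m))" if "finite S" for S
    using that
  proof induction
    case empty
    show ?case using single[of undefined 0] by simp
  qed (auto intro: single add)
  from this[of "keys p"] show ?thesis
    using gpoly_decompose[of p] by simp
qed

section \<open>Ring homomorphisms defined on terms\<close>

definition gextend :: "((gindex \<Rightarrow>\<^sub>0 nat) \<Rightarrow> 'k \<Rightarrow> 'a) \<Rightarrow> 'k::field gpoly \<Rightarrow> 'a::comm_ring_1"
  where "gextend \<phi> p = (\<Sum>m\<in>keys p. \<phi> m (lookup p m))"

text \<open>Covers both homomorphisms out of the polynomial ring that are needed: the substitution
  of polynomials for variables and the grading by weight.\<close>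

locale coeff_extension =
  fixes \<phi> :: "(gindex \<Rightarrow>\<^sub>0 nat) \<Rightarrow> 'k::field \<Rightarrow> 'a::comm_ring_1"
  assumes coeff_add: "\<phi> m (c + c') = \<phi> m c + \<phi> m c'"
    and coeff_mult: "\<phi> (m + m') (c * c') = \<phi> m c * \<phi> m' c'"
    and coeff_one: "\<phi> 0 1 = 1"
begin

lemma coeff_zero: "\<phi> m 0 = 0"
  using coeff_add[of m 0 0] by simp

lemma extend_superset: "finite S \<Longrightarrow> keys p \<subseteq> S \<Longrightarrow> gextend \<phi> p = (\<Sum>m\<in>S. \<phi> m (lookup p m))"
  unfolding gextend_def by (rule sum.mono_neutral_left) (auto simp: in_keys_iff coeff_zero)

lemma extend_single: "gextend \<phi> (Poly_Mapping.single m c) = \<phi> m c"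
  by (subst extend_superset[of "{m}"]) auto

lemma extend_add: "gextend \<phi> (p + q) = gextend \<phi> p + gextend \<phi> q"
proof -
  let ?S = "keys p \<union> keys q"
  have "gextend \<phi> (p + q) = (\<Sum>m\<in>?S. \<phi> m (lookup (p + q) m))"
    using keys_add[of p q] by (intro extend_superset) auto
  also have "\<dots> = (\<Sum>m\<in>?S. \<phi> m (lookup p m)) + (\<Sum>m\<in>?S. \<phi> m (lookup q m))"
    by (simp add: lookup_add coeff_add sum.distrib)
  finally show ?thesis
    using extend_superset[of ?S p] extend_superset[of ?S q] by simp
qed

lemma extend_mult: "gextend \<phi> (p * q) = gextend \<phi> p * gextend \<phi> q"
proof (induction p rule: gpoly_induct)
  case (single m c)
  show ?case
    by (induction q rule: gpoly_induct)
      (auto simp: mult_single extend_single coeff_mult extend_add distrib_left)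
qed (auto simp: extend_add distrib_right)

lemma extend_zero: "gextend \<phi> 0 = 0"
  by (simp add: gextend_def)

sublocale comm_ring_hom "gextend \<phi>"
  by unfold_locales
    (auto simp: extend_add extend_mult extend_single coeff_one extend_zero simp flip: single_one)

end

definition mono_wt :: "(gindex \<Rightarrow> nat) \<Rightarrow> (gindex \<Rightarrow>\<^sub>0 nat) \<Rightarrow> nat"
  where "mono_wt w m = (\<Sum>v\<in>keys m. lookup m v * w v)"

definition mono_eval :: "(gindex \<Rightarrow> 'a::comm_ring_1) \<Rightarrow> (gindex \<Rightarrow>\<^sub>0 nat) \<Rightarrow> 'a"
  where "mono_eval \<theta> m = (\<Prod>v\<in>keys m. \<theta> v ^ lookup m v)"

lemma keys_add_nat: "keys (m + m') = keys m \<union> keys (m' :: 'v \<Rightarrow>\<^sub>0 nat)"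
  by (auto simp: in_keys_iff lookup_add)

lemma mono_wt_superset: "finite S \<Longrightarrow> keys m \<subseteq> S \<Longrightarrow> mono_wt w m = (\<Sum>v\<in>S. lookup m v * w v)"
  unfolding mono_wt_def by (rule sum.mono_neutral_left) (auto simp: in_keys_iff)

lemma mono_eval_superset:
  "finite S \<Longrightarrow> keys m \<subseteq> S \<Longrightarrow> mono_eval \<theta> m = (\<Prod>v\<in>S. \<theta> v ^ lookup m v)"
  unfolding mono_eval_def by (rule prod.mono_neutral_left) (auto simp: in_keys_iff)

lemma mono_wt_add: "mono_wt w (m + m') = mono_wt w m + mono_wt w m'"
proof -
  let ?S = "keys m \<union> keys m'"
  have "mono_wt w (m + m') = (\<Sum>v\<in>?S. lookup (m + m') v * w v)"
    by (rule mono_wt_superset) (auto simp: keys_add_nat)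
  also have "\<dots> = (\<Sum>v\<in>?S. lookup m v * w v) + (\<Sum>v\<in>?S. lookup m' v * w v)"
    by (simp add: lookup_add distrib_right sum.distrib)
  finally show ?thesis
    using mono_wt_superset[of ?S m w] mono_wt_superset[of ?S m' w] by simp
qed

lemma mono_eval_add: "mono_eval \<theta> (m + m') = mono_eval \<theta> m * mono_eval \<theta> m'"
proof -
  let ?S = "keys m \<union> keys m'"
  have "mono_eval \<theta> (m + m') = (\<Prod>v\<in>?S. \<theta> v ^ lookup (m + m') v)"
    by (rule mono_eval_superset) (auto simp: keys_add_nat)
  also have "\<dots> = (\<Prod>v\<in>?S. \<theta> v ^ lookup m v) * (\<Prod>v\<in>?S. \<theta> v ^ lookup m' v)"
    by (simp add: lookup_add power_add prod.distrib)
  finally show ?thesis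
    using mono_eval_superset[of ?S m \<theta>] mono_eval_superset[of ?S m' \<theta>] by simp
qed

lemma mono_wt_zero [simp]: "mono_wt w 0 = 0"
  by (simp add: mono_wt_def)

lemma mono_eval_zero [simp]: "mono_eval \<theta> 0 = 1"
  by (simp add: mono_eval_def)

lemma mono_wt_eq_0_iff: "mono_wt w m = 0 \<longleftrightarrow> (\<forall>v\<in>keys m. w v = 0)"
  by (auto simp: mono_wt_def in_keys_iff)

lemma gconst_add: "gconst (c + c') = gconst c + gconst c'"
  by (simp add: gconst_def single_add)

lemma gconst_mult: "gconst (c * c') = gconst c * gconst c'"
  by (simp add: gconst_def mult_single)

lemma gconst_1 [simp]: "gconst 1 = 1"
  by (simp add: gconst_def)

lemma gconst_0 [simp]: "gconst 0 = 0"
  by (simp add: gconst_def)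

lemma gconst_eq_0_iff [simp]: "gconst c = 0 \<longleftrightarrow> c = 0"
  by (metis gconst_0 gconst_def inj_single injD)

definition gsubst :: "(gindex \<Rightarrow> 'k::field gpoly) \<Rightarrow> 'k gpoly \<Rightarrow> 'k gpoly"
  where "gsubst \<theta> = gextend (\<lambda>m c. gconst c * mono_eval \<theta> m)"

interpretation subst_ext: coeff_extension "\<lambda>m c. gconst c * mono_eval \<theta> m" for \<theta> :: "gindex \<Rightarrow> 'k::field gpoly"
  by unfold_locales (auto simp: gconst_add gconst_mult mono_eval_add algebra_simps)

interpretation gsubst: comm_ring_hom "gsubst \<theta>" for \<theta> :: "gindex \<Rightarrow> 'k::field gpoly"
  unfolding gsubst_def by (rule subst_ext.comm_ring_hom_axioms)

lemma gsubst_single: "gsubst \<theta> (Poly_Mapping.single m c) = gconst c * mono_eval \<theta> m"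
  unfolding gsubst_def by (rule subst_ext.extend_single)

lemma gsubst_gconst [simp]: "gsubst \<theta> (gconst c) = gconst c"
  by (simp add: gconst_def gsubst_single)

lemma gsubst_gvar [simp]: "gsubst \<theta> (gvar v) = \<theta> v"
  by (simp add: gvar_def gsubst_single mono_eval_def)

lemma mono_eval_gvar: "mono_eval gvar m = (Poly_Mapping.single m 1 :: 'k::field gpoly)"
proof -
  have pow: "(gvar v :: 'k gpoly) ^ e = Poly_Mapping.single (Poly_Mapping.single v e) 1" for v e
    by (induction e) (auto simp: gvar_def mult_single simp flip: single_add)
  have "finite S \<Longrightarrow> (\<Prod>v\<in>S. (gvar v :: 'k gpoly) ^ lookup m v)
     = Poly_Mapping.single (\<Sum>v\<in>S. Poly_Mapping.single v (lookup m v)) 1" for S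
    by (induction S rule: finite_induct) (auto simp: pow mult_single)
  moreover have "(\<Sum>v\<in>keys m. Poly_Mapping.single v (lookup m v)) = m"
  proof (rule poly_mapping_eqI)
    fix v
    have "lookup (\<Sum>v\<in>keys m. Poly_Mapping.single v (lookup m v)) v
        = (\<Sum>v'\<in>keys m. if v' = v then lookup m v' else 0)"
      unfolding lookup_sum by (intro sum.cong) (auto simp: lookup_single when_def)
    also have "\<dots> = lookup m v"
      by (auto simp: sum.delta in_keys_iff)
    finally show "lookup (\<Sum>v\<in>keys m. Poly_Mapping.single v (lookup m v)) v = lookup m v" .
  qed
  ultimately show ?thesis
    by (simp add: mono_eval_def)
qed

lemma gsubst_gsubst: "gsubst \<theta> (gsubst \<eta> p) = gsubst (\<lambda>v. gsubst \<theta> (\<eta> v)) p"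
proof (induction p rule: gpoly_induct)
  case (single m c)
  show ?case
    by (simp add: gsubst_single gsubst.hom_mult mono_eval_def gsubst.hom_prod gsubst.hom_power)
qed (auto simp: gsubst.hom_add)

text \<open>Recording the weight of each monomial as the exponent of an extra variable turns weighted
  degrees into degrees of univariate polynomials over an integral domain.\<close>

definition weight_poly :: "(gindex \<Rightarrow> nat) \<Rightarrow> 'k::field gpoly \<Rightarrow> 'k gpoly poly"
  where "weight_poly w = gextend (\<lambda>m c. monom (Poly_Mapping.single m c) (mono_wt w m))"

definition wdeg :: "(gindex \<Rightarrow> nat) \<Rightarrow> 'k::field gpoly \<Rightarrow> nat"
  where "wdeg w p = degree (weight_poly w p)"

interpretation weight_ext: coeff_extension "\<lambda>m (c::'k::field). monom (Poly_Mapping.single m c) (mono_wt w m)" for w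
  by unfold_locales (auto simp: single_add add_monom mult_monom mult_single mono_wt_add)

interpretation weight_poly: comm_ring_hom "weight_poly w :: 'k::field gpoly \<Rightarrow> _" for w
  unfolding weight_poly_def by (rule weight_ext.comm_ring_hom_axioms)

lemma weight_poly_single:
  "weight_poly w (Poly_Mapping.single m c) = monom (Poly_Mapping.single m c) (mono_wt w m)"
  unfolding weight_poly_def by (rule weight_ext.extend_single)

text \<open>The coefficient at exponent \<open>e\<close> is the homogeneous part of weight
  \<open>e\<close>. So \<open>weight_poly\<close> is injective, and for nonzero \<open>p\<close> its
  degree is the largest weight of a monomial of \<open>p\<close>.\<close>

lemma lookup_coeff_weight_poly:
  "lookup (coeff (weight_poly w p) e) m = (if mono_wt w m = e then lookup p m else 0)"
proof (induction p rule: gpoly_induct)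
  case (single m' c)
  show ?case
    by (auto simp: weight_poly_single lookup_single when_def)
qed (auto simp: weight_poly.hom_add lookup_add)

lemma weight_poly_eq_0_iff [simp]: "weight_poly w p = 0 \<longleftrightarrow> p = 0"
proof
  assume "weight_poly w p = 0"
  then have "lookup p m = 0" for m
    using lookup_coeff_weight_poly[of w p "mono_wt w m" m] by simp
  then show "p = 0"
    by (intro poly_mapping_eqI) simp
qed simp

lemma mono_wt_le_wdeg: "m \<in> keys p \<Longrightarrow> mono_wt w m \<le> wdeg w p"
  unfolding wdeg_def
proof (rule le_degree)
  assume "m \<in> keys p"
  then have "lookup (coeff (weight_poly w p) (mono_wt w m)) m \<noteq> 0"
    by (simp add: lookup_coeff_weight_poly in_keys_iff)
  then show "coeff (weight_poly w p) (mono_wt w m) \<noteq> 0"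
    by auto
qed

lemma wdeg_leI:
  assumes "\<And>m. m \<in> keys p \<Longrightarrow> mono_wt w m \<le> e"
  shows "wdeg w p \<le> e"
  unfolding wdeg_def
proof (rule degree_le, intro allI impI poly_mapping_eqI)
  fix e' m assume "e < e'"
  then show "lookup (coeff (weight_poly w p) e') m = lookup 0 m"
    using assms[of m] by (cases "m \<in> keys p") (auto simp: lookup_coeff_weight_poly in_keys_iff)
qed

text \<open>With the indicator of a set of variables as weight, this says that none of them occurs
  in \<open>p\<close>. As degrees of nonzero polynomials add, the property passes from a nonzero
  product to its factors.\<close>

lemma wdeg_eq_0_iff: "wdeg w p = 0 \<longleftrightarrow> (\<forall>m\<in>keys p. \<forall>v\<in>keys m. w v = 0)"
proof -
  have "wdeg w p = 0 \<longleftrightarrow> (\<forall>m\<in>keys p. mono_wt w m = 0)"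
    using mono_wt_le_wdeg[of _ p w] wdeg_leI[of p w 0] by fastforce
  then show ?thesis by (simp add: mono_wt_eq_0_iff)
qed

lemma wdeg_mult:
  fixes p q :: "'k::field gpoly"
  assumes "p \<noteq> 0" "q \<noteq> 0"
  shows "wdeg w (p * q) = wdeg w p + wdeg w q"
  using assms by (simp add: wdeg_def weight_poly.hom_mult degree_mult_eq)

lemma wdeg_mult_le: "wdeg w (p * q) \<le> wdeg w p + wdeg w q"
  by (simp add: wdeg_def weight_poly.hom_mult degree_mult_le)

lemma wdeg_add_le: "wdeg w p \<le> e \<Longrightarrow> wdeg w q \<le> e \<Longrightarrow> wdeg w (p + q) \<le> e"
  by (simp add: wdeg_def weight_poly.hom_add degree_add_le)

lemma wdeg_uminus [simp]: "wdeg w (- p) = wdeg w p"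
  by (simp add: wdeg_def weight_poly.hom_uminus)

lemma wdeg_diff_le: "wdeg w p \<le> e \<Longrightarrow> wdeg w q \<le> e \<Longrightarrow> wdeg w (p - q) \<le> e"
  by (simp add: wdeg_def weight_poly.hom_minus degree_diff_le)

lemma wdeg_gconst [simp]: "wdeg w (gconst c) = 0"
  by (auto simp: wdeg_eq_0_iff gconst_def split: if_splits)

lemma wdeg_0 [simp]: "wdeg w 0 = 0"
  using wdeg_gconst[of w 0] by simp

lemma wdeg_1 [simp]: "wdeg w 1 = 0"
  using wdeg_gconst[of w 1] by simp

lemma wdeg_gvar [simp]: "wdeg w (gvar v :: 'k::field gpoly) = w v"
proof -
  have "Poly_Mapping.single (Poly_Mapping.single v 1) (1::'k) \<noteq> (0 :: 'k gpoly)"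
    by (metis lookup_single_eq lookup_zero zero_neq_one)
  then show ?thesis
    by (simp add: wdeg_def gvar_def weight_poly_single degree_monom_eq mono_wt_def)
qed

lemma wdeg_sum_le: "(\<And>i. i \<in> S \<Longrightarrow> wdeg w (f i) \<le> e) \<Longrightarrow> wdeg w (\<Sum>i\<in>S. f i) \<le> e"
  by (induction S rule: infinite_finite_induct) (auto intro: wdeg_add_le)

lemma wdeg_prod_le: "wdeg w (\<Prod>i\<in>S. f i) \<le> (\<Sum>i\<in>S. wdeg w (f i))"
proof (induction S rule: infinite_finite_induct)
  case (insert i S)
  then show ?case using wdeg_mult_le[of w "f i" "\<Prod>i\<in>S. f i"] by simp
qed auto

lemma wdeg_power_le: "wdeg w (p ^ e) \<le> e * wdeg w p"
proof (induction e)
  case (Suc e)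
  then show ?case using wdeg_mult_le[of w p "p ^ e"] by simp
qed auto

text \<open>Serves mostly for lower bounds: a degree that is visible after a specialization was
  present before it.\<close>

lemma wdeg_gsubst_le:
  assumes "\<And>v. wdeg w (\<theta> v) \<le> w' v"
  shows "wdeg w (gsubst \<theta> p) \<le> wdeg w' p"
proof -
  have "gsubst \<theta> p = (\<Sum>m\<in>keys p. gconst (lookup p m) * mono_eval \<theta> m)"
    by (simp add: gsubst_def gextend_def)
  also have "wdeg w \<dots> \<le> wdeg w' p"
  proof (rule wdeg_sum_le)
    fix m assume m: "m \<in> keys p"
    have "wdeg w (mono_eval \<theta> m) \<le> (\<Sum>v\<in>keys m. wdeg w (\<theta> v ^ lookup m v))"
      unfolding mono_eval_def by (rule wdeg_prod_le)
    also have "\<dots> \<le> mono_wt w' m"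
      unfolding mono_wt_def
      by (intro sum_mono order.trans[OF wdeg_power_le] mult_le_mono2 assms)
    also have "\<dots> \<le> wdeg w' p"
      by (rule mono_wt_le_wdeg) (rule m)
    finally show "wdeg w (gconst (lookup p m) * mono_eval \<theta> m) \<le> wdeg w' p"
      using wdeg_mult_le[of w "gconst (lookup p m)" "mono_eval \<theta> m"] by simp
  qed
  finally show ?thesis .
qed

lemma mono_wt_scale_le: "(\<And>v. c * w v \<le> w' v) \<Longrightarrow> c * mono_wt w m \<le> mono_wt w' m"
  unfolding mono_wt_def sum_distrib_left
  by (intro sum_mono) (metis mult.left_commute mult_le_mono2)

lemma wdeg_scale_le:
  assumes "\<And>v. c * w v \<le> w' v"
  shows "c * wdeg w p \<le> wdeg w' p"
proof (cases "wdeg w p = 0")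
  case False
  then obtain m where "m \<in> keys p" "mono_wt w m \<ge> wdeg w p"
    using wdeg_leI[of p w "wdeg w p - 1"] by fastforce
  then show ?thesis
    using mono_wt_scale_le[of c w w' m, OF assms] mono_wt_le_wdeg[of m p w']
    by (meson le_trans mult_le_mono2)
qed simp

section \<open>Restriction to a set of variables\<close>

definition grestrict :: "gindex set \<Rightarrow> 'k::field gpoly \<Rightarrow> 'k gpoly"
  where "grestrict T = gsubst (\<lambda>v. if v \<in> T then gvar v else 0)"

text \<open>Setting variables to 0 keeps a monomial or deletes it. Restriction is therefore a ring
  homomorphism that only selects monomials and never merges them.\<close>

lemma lookup_grestrict: "lookup (grestrict T p) m = (if keys m \<subseteq> T then lookup p m else 0)"
proof (induction p rule: gpoly_induct)
  case (single m' c)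
  let ?\<theta> = "\<lambda>v. if v \<in> T then gvar v else (0::'a gpoly)"
  have "mono_eval ?\<theta> m' = (if keys m' \<subseteq> T then Poly_Mapping.single m' 1 else 0)"
  proof (cases "keys m' \<subseteq> T")
    case True
    then have "mono_eval ?\<theta> m' = mono_eval gvar m'"
      unfolding mono_eval_def by (intro prod.cong) auto
    then show ?thesis using True by (simp add: mono_eval_gvar)
  next
    case False
    then obtain v where "v \<in> keys m'" "v \<notin> T" by auto
    then show ?thesis
      using False unfolding mono_eval_def
      by (auto intro!: prod_zero bexI[of _ v] simp: in_keys_iff)
  qed
  then show ?case
    by (auto simp: grestrict_def gsubst_single gconst_def mult_single lookup_single when_def)
qed (auto simp: grestrict_def gsubst.hom_add lookup_add)

lemma keys_grestrict: "keys (grestrict T p) = {m \<in> keys p. keys m \<subseteq> T}"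
  unfolding set_eq_iff in_keys_iff lookup_grestrict by simp

lemma wdeg_grestrict_le: "wdeg w (grestrict T p) \<le> wdeg w p"
  by (rule wdeg_leI) (simp add: keys_grestrict mono_wt_le_wdeg)

lemma grestrict_grestrict: "grestrict S (grestrict T p) = grestrict (S \<inter> T) p"
  by (rule poly_mapping_eqI) (simp add: lookup_grestrict)

interpretation grestrict: comm_ring_hom "grestrict T :: 'k::field gpoly \<Rightarrow> _" for T
  unfolding grestrict_def by (rule gsubst.comm_ring_hom_axioms)

lemma gpoly_const_iff: "(\<exists>c. p = gconst c) \<longleftrightarrow> keys p \<subseteq> {0}"
proof
  assume "keys p \<subseteq> {0}"
  then have "p = gconst (lookup p 0)"
    by (intro poly_mapping_eqI) (auto simp: gconst_def lookup_single when_def in_keys_iff)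
  then show "\<exists>c. p = gconst c" ..
qed (auto simp: gconst_def split: if_splits)

section \<open>Determinants over finite index sets\<close>

text \<open>Arbitrary index sets allow nodes to be added, removed and renamed without fixing an
  order.\<close>

definition fdet :: "'i set \<Rightarrow> ('i \<Rightarrow> 'i \<Rightarrow> 'a) \<Rightarrow> 'a::comm_ring_1"
  where "fdet S F = (\<Sum>p | p permutes S. of_int (sign p) * (\<Prod>i\<in>S. F i (p i)))"

lemma fdet_cong:
  assumes "\<And>i j. i \<in> S \<Longrightarrow> j \<in> S \<Longrightarrow> F i j = F' i j"
  shows "fdet S F = fdet S F'"
  unfolding fdet_def using assms
  by (intro sum.cong arg_cong2[of _ _ _ _ "(*)"] prod.cong refl) (auto simp: permutes_in_image)

lemma fdet_mat: "fdet {0..<n} F = det (mat n n (\<lambda>(i, j). F i j))"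
proof -
  have "p i < n" if "p permutes {0..<n}" "i < n" for p i
    using permutes_in_image[OF that(1), of i] that(2) by simp
  then show ?thesis
    unfolding fdet_def det_def
    by (auto intro!: sum.cong arg_cong2[of _ _ _ _ "(*)"] prod.cong)
qed

text \<open>Conjugation by the bijection matches the permutations of both sets and preserves
  signs.\<close>

lemma fdet_reindex:
  assumes f: "bij_betw f T S" and T: "finite T"
  shows "fdet S F = fdet T (\<lambda>i j. F (f i) (f j))"
proof -
  let ?g = "inv_into T f"
  have g: "bij_betw ?g S T" by (rule bij_betw_inv_into[OF f])
  have inj: "inj_on f T" and im: "f ` T = S" using f by (auto simp: bij_betw_def)
  have gf: "?g (f x) = x" if "x \<in> T" for x using inj that by (rule inv_into_f_f)
  have fg: "f (?g x) = x" if "x \<in> S" for x using that im by (auto intro: f_inv_into_f)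
  show ?thesis
    unfolding fdet_def
  proof (rule sum.reindex_bij_witness[of _ "map_permutation T f" "map_permutation S ?g"], goal_cases)
    case (1 p)
    then show ?case using map_permutation_compose_inv[OF g, of p f] fg by auto
  next
    case (2 p)
    then show ?case using map_permutation_permutes[OF g, of p] by auto
  next
    case (3 p)
    then show ?case using map_permutation_compose_inv[OF f, of p ?g] gf by auto
  next
    case (4 p)
    then show ?case using map_permutation_permutes[OF f, of p] by auto
  next
    case (5 p)
    then have p: "p permutes S" by simp
    have injg: "inj_on ?g S" using g by (simp add: bij_betw_def)
    have fin: "finite S" using T im by auto
    have "(\<Prod>i\<in>T. F (f i) (f (map_permutation S ?g p i))) = (\<Prod>i\<in>S. F i (p i))"
    proof (rule prod.reindex_bij_betw[OF g, symmetric, THEN trans])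
      show "(\<Prod>x\<in>S. F (f (?g x)) (f (map_permutation S ?g p (?g x)))) = (\<Prod>i\<in>S. F i (p i))"
        using p by (intro prod.cong refl) (simp add: map_permutation_apply[OF injg] fg permutes_in_image)
    qed
    then show ?case using sign_map_permutation[OF injg p fin] by simp
  qed
qed

lemma fdet_empty [simp]: "fdet {} F = 1"
  by (simp add: fdet_def)

lemma fdet_singleton [simp]: "fdet {i} F = F i i"
  by (simp add: fdet_def)

lemma fdet_hom:
  assumes "comm_ring_hom h"
  shows "h (fdet S F) = fdet S (\<lambda>i j. h (F i j))"
proof -
  interpret h: comm_ring_hom h by fact
  show ?thesis
    unfolding fdet_def h.hom_sum h.hom_mult h.hom_prod
    by (intro sum.cong refl) (auto simp: sign_def h.hom_uminus)
qed

text \<open>Numbering \<open>S\<close> before \<open>T\<close> gives access to the rules for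
  determinants of block matrices.\<close>

lemma fdet_two_blocks:
  fixes F :: "'i \<Rightarrow> 'i \<Rightarrow> 'a::comm_ring_1"
  assumes fin: "finite S" "finite T" and disj: "S \<inter> T = {}"
  obtains e e' where "bij_betw e {0..<card S} S" "bij_betw e' {0..<card T} T"
    "fdet (S \<union> T) F = det (four_block_mat
       (mat (card S) (card S) (\<lambda>(i, j). F (e i) (e j))) (mat (card S) (card T) (\<lambda>(i, j). F (e i) (e' j)))
       (mat (card T) (card S) (\<lambda>(i, j). F (e' i) (e j))) (mat (card T) (card T) (\<lambda>(i, j). F (e' i) (e' j))))"
proof -
  obtain e where e: "bij_betw e {0..<card S} S" using ex_bij_betw_nat_finite[OF fin(1)] by blast
  obtain e' where e': "bij_betw e' {0..<card T} T" using ex_bij_betw_nat_finite[OF fin(2)] by blast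
  let ?m = "card S" and ?n = "card T"
  let ?f = "\<lambda>i. if i < ?m then e i else e' (i - ?m)"
  have "bij_betw (\<lambda>i. i - ?m) {?m..<?m + ?n} {0..<?n}"
    by (rule bij_betw_byWitness[of _ "\<lambda>i. i + ?m"]) auto
  from bij_betw_trans[OF this e'] have "bij_betw (\<lambda>i. e' (i - ?m)) {?m..<?m + ?n} T"
    by (simp add: o_def)
  then have 1: "bij_betw ?f {?m..<?m + ?n} T"
    by (rule bij_betw_cong[THEN iffD1, rotated]) auto
  have 2: "bij_betw ?f {0..<?m} S"
    by (rule bij_betw_cong[THEN iffD1, OF _ e]) auto
  have "bij_betw ?f ({0..<?m} \<union> {?m..<?m + ?n}) (S \<union> T)"
    by (rule bij_betw_combine[OF 2 1 disj])
  then have f: "bij_betw ?f {0..<?m + ?n} (S \<union> T)"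
    by (simp add: ivl_disj_un)
  have "fdet (S \<union> T) F = det (mat (?m + ?n) (?m + ?n) (\<lambda>(i, j). F (?f i) (?f j)))"
    by (subst fdet_reindex[OF f]) (simp_all add: fdet_mat)
  also have "mat (?m + ?n) (?m + ?n) (\<lambda>(i, j). F (?f i) (?f j)) = four_block_mat
       (mat ?m ?m (\<lambda>(i, j). F (e i) (e j))) (mat ?m ?n (\<lambda>(i, j). F (e i) (e' j)))
       (mat ?n ?m (\<lambda>(i, j). F (e' i) (e j))) (mat ?n ?n (\<lambda>(i, j). F (e' i) (e' j)))"
    by (rule eq_matI) auto
  finally show ?thesis using e e' that by blast
qed

lemma fdet_enum: "bij_betw e {0..<n} S \<Longrightarrow> fdet S F = det (mat n n (\<lambda>(i, j). F (e i) (e j)))"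
  by (simp add: fdet_reindex fdet_mat)

lemma fdet_block_triangular:
  fixes F :: "'i \<Rightarrow> 'i \<Rightarrow> 'a::idom"
  assumes fin: "finite S" "finite T" and disj: "S \<inter> T = {}"
    and zero: "\<And>i j. i \<in> S \<Longrightarrow> j \<in> T \<Longrightarrow> F i j = 0"
  shows "fdet (S \<union> T) F = fdet S F * fdet T F"
proof -
  obtain e e' where e: "bij_betw e {0..<card S} S" and e': "bij_betw e' {0..<card T} T"
    and *: "fdet (S \<union> T) F = det (four_block_mat
       (mat (card S) (card S) (\<lambda>(i, j). F (e i) (e j))) (mat (card S) (card T) (\<lambda>(i, j). F (e i) (e' j)))
       (mat (card T) (card S) (\<lambda>(i, j). F (e' i) (e j))) (mat (card T) (card T) (\<lambda>(i, j). F (e' i) (e' j))))"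
    using fdet_two_blocks[OF fin disj, of F] by blast
  have "mat (card S) (card T) (\<lambda>(i, j). F (e i) (e' j)) = 0\<^sub>m (card S) (card T)"
    using bij_betwE[OF e] bij_betwE[OF e'] by (intro eq_matI) (auto simp: zero)
  then show ?thesis
    unfolding * fdet_enum[OF e] fdet_enum[OF e']
    by (intro det_four_block_mat_upper_right_zero) auto
qed

lemma fdet_diagonal:
  fixes F :: "'i \<Rightarrow> 'i \<Rightarrow> 'a::idom"
  assumes "finite S" "\<And>i j. i \<in> S \<Longrightarrow> j \<in> S \<Longrightarrow> i \<noteq> j \<Longrightarrow> F i j = 0"
  shows "fdet S F = (\<Prod>i\<in>S. F i i)"
  using assms
proof (induction S rule: finite_induct)
  case (insert i S)
  then have "fdet ({i} \<union> S) F = F i i * fdet S F"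
    by (subst fdet_block_triangular) auto
  then show ?case using insert by auto
qed simp

text \<open>Schur complement with respect to the identity block on \<open>T\<close>: the block
  matrix is the product of an upper block triangular matrix with diagonal blocks \<open>E\<close>, 1
  and a lower unitriangular one.\<close>

lemma fdet_eliminate:
  fixes F :: "'i \<Rightarrow> 'i \<Rightarrow> 'a::idom"
  assumes fin: "finite S" "finite T" and disj: "S \<inter> T = {}"
    and one: "\<And>i j. i \<in> T \<Longrightarrow> j \<in> T \<Longrightarrow> F i j = (if i = j then 1 else 0)"
  shows "fdet (S \<union> T) F = fdet S (\<lambda>i j. F i j - (\<Sum>k\<in>T. F i k * F k j))"
proof -
  let ?m = "card S" and ?n = "card T"
  obtain e e' where e: "bij_betw e {0..<?m} S" and e': "bij_betw e' {0..<?n} T"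
    and *: "fdet (S \<union> T) F = det (four_block_mat
       (mat ?m ?m (\<lambda>(i, j). F (e i) (e j))) (mat ?m ?n (\<lambda>(i, j). F (e i) (e' j)))
       (mat ?n ?m (\<lambda>(i, j). F (e' i) (e j))) (mat ?n ?n (\<lambda>(i, j). F (e' i) (e' j))))"
      (is "_ = det (four_block_mat ?A ?B ?C ?D)")
    using fdet_two_blocks[OF fin disj, of F] by blast
  let ?E = "mat ?m ?m (\<lambda>(i, j). F (e i) (e j) - (\<Sum>k\<in>T. F (e i) k * F k (e j)))"
  have D: "?D = 1\<^sub>m ?n"
    using bij_betwE[OF e'] bij_betw_imp_inj_on[OF e']
    by (intro eq_matI) (auto simp: one inj_on_def)
  have BC: "?B * ?C = mat ?m ?m (\<lambda>(i, j). \<Sum>k\<in>T. F (e i) k * F k (e j))"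
  proof (rule eq_matI)
    fix i j assume "i < dim_row (mat ?m ?m (\<lambda>(i, j). \<Sum>k\<in>T. F (e i) k * F k (e j)))"
      "j < dim_col (mat ?m ?m (\<lambda>(i, j). \<Sum>k\<in>T. F (e i) k * F k (e j)))"
    then show "(?B * ?C) $$ (i, j) = mat ?m ?m (\<lambda>(i, j). \<Sum>k\<in>T. F (e i) k * F k (e j)) $$ (i, j)"
      using sum.reindex_bij_betw[OF e', of "\<lambda>k. F (e i) k * F k (e j)"]
      by (simp add: scalar_prod_def)
  qed auto
  have EA: "?E + ?B * ?C = ?A"
    unfolding BC by (rule eq_matI) auto
  have "four_block_mat ?A ?B ?C ?D
      = four_block_mat ?E ?B (0\<^sub>m ?n ?m) (1\<^sub>m ?n) * four_block_mat (1\<^sub>m ?m) (0\<^sub>m ?m ?n) ?C (1\<^sub>m ?n)"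
    unfolding D
    by (subst mult_four_block_mat[of _ ?m ?m _ ?n _ ?n _ _ ?m _ ?n])
      (auto simp: EA right_mult_one_mat[of _ ?m] right_mult_one_mat[of _ ?n] left_mult_one_mat[of _ ?n])
  also have "det \<dots> = det ?E"
    by (subst det_mult[of _ "?m + ?n"])
      (auto simp: det_four_block_mat_lower_left_zero[of _ ?m _ ?n]
          det_four_block_mat_upper_right_zero[of _ ?m _ ?n])
  finally show ?thesis
    unfolding * fdet_enum[OF e] .
qed

text \<open>Each term of the Leibniz expansion takes exactly one entry from every row and every
  column, so it collects each row weight and each column weight once.\<close>

lemma wdeg_fdet_le:
  assumes fin: "finite S"
    and F: "\<And>i j. i \<in> S \<Longrightarrow> j \<in> S \<Longrightarrow> wdeg w (F i j) \<le> r i + c j"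
  shows "wdeg w (fdet S F) \<le> sum r S + sum c S"
  unfolding fdet_def
proof (rule wdeg_sum_le)
  fix p assume "p \<in> {p. p permutes S}"
  then have p: "p permutes S" by simp
  have sgn: "wdeg w (of_int (sign p) * q) = wdeg w q" for q
    by (auto simp: sign_def)
  have "wdeg w (\<Prod>i\<in>S. F i (p i)) \<le> (\<Sum>i\<in>S. wdeg w (F i (p i)))"
    by (rule wdeg_prod_le)
  also have "\<dots> \<le> (\<Sum>i\<in>S. r i + c (p i))"
    using p by (intro sum_mono F) (auto simp: permutes_in_image)
  also have "\<dots> = sum r S + sum c S"
    using sum.permute[OF p, of c] by (simp add: sum.distrib o_def)
  finally show "wdeg w (of_int (sign p) * (\<Prod>i\<in>S. F i (p i))) \<le> sum r S + sum c S"
    by (simp only: sgn)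
qed

section \<open>Realizing matrices of the generated algebra by paths\<close>

text \<open>Indices are pairs of a node and a position inside a label, so \<open>B\<close> is a
  graph whose edge labels are its blocks with fixed pair of nodes. Support in \<open>V\<close> means
  that all edges run inside \<open>V\<close>.\<close>

definition supported :: "nat set \<Rightarrow> (nat \<times> nat \<Rightarrow> nat \<times> nat \<Rightarrow> 'a::zero) \<Rightarrow> bool"
  where "supported V B \<longleftrightarrow> (\<forall>\<rho> \<sigma>. fst \<rho> \<notin> V \<or> fst \<sigma> \<notin> V \<longrightarrow> B \<rho> \<sigma> = 0)"

definition edge :: "nat \<Rightarrow> nat \<Rightarrow> 'k gpoly \<Rightarrow> 'k::field mat \<Rightarrow> nat \<times> nat \<Rightarrow> nat \<times> nat \<Rightarrow> 'k gpoly"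
  where "edge r c z Q \<rho> \<sigma> =
    (if fst \<rho> = r \<and> fst \<sigma> = c then z * gconst (Q $$ (snd \<rho>, snd \<sigma>)) else 0)"

definition supported_tuple :: "nat set \<Rightarrow> (nat \<Rightarrow> nat \<Rightarrow> nat \<Rightarrow> 'a::zero) \<Rightarrow> bool"
  where "supported_tuple V \<Xi> \<longleftrightarrow> (\<forall>j r c. r \<notin> V \<or> c \<notin> V \<longrightarrow> \<Xi> j r c = 0)"

text \<open>Stands in for membership of the entries in the ideal generated by \<open>Z\<close>, in
  the form in which it is applied: a restriction that kills \<open>Z\<close> kills the entries
  too.\<close>

definition vanishes_with :: "'k::field gpoly set \<Rightarrow> (nat \<Rightarrow> nat \<Rightarrow> nat \<Rightarrow> 'k gpoly) \<Rightarrow> bool"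
  where "vanishes_with Z \<Xi> \<longleftrightarrow>
    (\<forall>\<theta>. (\<forall>z\<in>Z. gsubst \<theta> z = 0) \<longrightarrow> (\<forall>j r c. gsubst \<theta> (\<Xi> j r c) = 0))"

lemma supported_mono: "supported V B \<Longrightarrow> V \<subseteq> W \<Longrightarrow> supported W B"
  by (auto simp: supported_def)

lemma supported_add:
  fixes B B' :: "nat \<times> nat \<Rightarrow> nat \<times> nat \<Rightarrow> 'a::monoid_add"
  shows "supported V B \<Longrightarrow> supported V B' \<Longrightarrow> supported V (\<lambda>\<rho> \<sigma>. B \<rho> \<sigma> + B' \<rho> \<sigma>)"
  by (auto simp: supported_def)

lemma supported_edge: "r \<in> V \<Longrightarrow> c \<in> V \<Longrightarrow> supported V (edge r c z Q)"
  by (auto simp: supported_def edge_def)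

locale pencil =
  fixes A :: "nat \<Rightarrow> 'k::field mat" and d g :: nat
  assumes A_carrier: "\<And>j. j < g \<Longrightarrow> A j \<in> carrier_mat d d"
begin

definition lin :: "(nat \<Rightarrow> nat \<Rightarrow> nat \<Rightarrow> 'k gpoly) \<Rightarrow> nat \<times> nat \<Rightarrow> nat \<times> nat \<Rightarrow> 'k gpoly"
  where "lin X \<rho> \<sigma> = (\<Sum>j<g. gconst (A j $$ (snd \<rho>, snd \<sigma>)) * X j (fst \<rho>) (fst \<sigma>))"

definition pdet :: "nat set \<Rightarrow> (nat \<times> nat \<Rightarrow> nat \<times> nat \<Rightarrow> 'k gpoly) \<Rightarrow> 'k gpoly"
  where "pdet V B = fdet (V \<times> {..<d}) (\<lambda>\<rho> \<sigma>. of_bool (\<rho> = \<sigma>) - B \<rho> \<sigma>)"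

lemma supported_lin: "supported_tuple V X \<Longrightarrow> supported V (lin X)"
  by (auto simp: supported_def supported_tuple_def lin_def)

lemma lin_add: "lin (\<lambda>j r c. X j r c + Y j r c) \<rho> \<sigma> = lin X \<rho> \<sigma> + lin Y \<rho> \<sigma>"
  by (simp add: lin_def distrib_left sum.distrib)

lemma pdet_cong:
  assumes "\<And>\<rho> \<sigma>. \<rho> \<in> V \<times> {..<d} \<Longrightarrow> \<sigma> \<in> V \<times> {..<d} \<Longrightarrow> B \<rho> \<sigma> = B' \<rho> \<sigma>"
  shows "pdet V B = pdet V B'"
  unfolding pdet_def by (rule fdet_cong) (simp add: assms)

text \<open>The added nodes are isolated, so eliminating their identity block changes
  nothing.\<close>

lemma pdet_extend:
  assumes "finite W" "V \<subseteq> W" "supported V B"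
  shows "pdet W B = pdet V B"
proof -
  let ?F = "\<lambda>\<rho> \<sigma>. of_bool (\<rho> = \<sigma>) - B \<rho> \<sigma>"
  have fin: "finite V" "finite (W - V)" using assms finite_subset by auto
  have "W \<times> {..<d} = V \<times> {..<d} \<union> (W - V) \<times> {..<d}" using assms(2) by auto
  then have "pdet W B = fdet (V \<times> {..<d} \<union> (W - V) \<times> {..<d}) ?F"
    by (simp only: pdet_def)
  also have "\<dots> = fdet (V \<times> {..<d}) (\<lambda>i j. ?F i j - (\<Sum>k\<in>(W - V) \<times> {..<d}. ?F i k * ?F k j))"
    using fin assms(3) by (intro fdet_eliminate) (auto simp: supported_def)
  also have "\<dots> = pdet V B"
    unfolding pdet_def using assms(3)
    by (intro fdet_cong) (auto intro!: sum.neutral simp: supported_def)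
  finally show ?thesis .
qed

text \<open>The node \<open>h\<close> has no loop, so its diagonal block is the identity and can be
  eliminated. The only edge into \<open>h\<close> comes from \<open>r\<close> and the only edge out
  of it goes to \<open>c\<close>, so the Schur complement adds just the product of their labels, at
  the edge from \<open>r\<close> to \<open>c\<close>.\<close>

lemma pdet_path:
  assumes fin: "finite V" and h: "h \<notin> V" and rc: "r \<in> V" "c \<in> V" and B: "supported V B"
    and Q: "Q \<in> carrier_mat d d" "Q' \<in> carrier_mat d d"
  shows "pdet (insert h V) (\<lambda>\<rho> \<sigma>. B \<rho> \<sigma> + edge h c z' Q' \<rho> \<sigma> + edge r h z Q \<rho> \<sigma>)
    = pdet V (\<lambda>\<rho> \<sigma>. B \<rho> \<sigma> + edge r c (z * z') (Q * Q') \<rho> \<sigma>)"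
proof -
  let ?T = "{h} \<times> {..<d}"
  let ?F = "\<lambda>\<rho> \<sigma>. of_bool (\<rho> = \<sigma>) - (B \<rho> \<sigma> + edge h c z' Q' \<rho> \<sigma> + edge r h z Q \<rho> \<sigma>)"
  have *: "?F (a, \<alpha>) (b, \<beta>) - (\<Sum>k\<in>?T. ?F (a, \<alpha>) k * ?F k (b, \<beta>))
      = of_bool ((a, \<alpha>) = (b, \<beta>)) - (B (a, \<alpha>) (b, \<beta>) + edge r c (z * z') (Q * Q') (a, \<alpha>) (b, \<beta>))"
    if a: "a \<in> V" "\<alpha> < d" and b: "b \<in> V" "\<beta> < d" for a b \<alpha> \<beta>
  proof -
    have Bz: "B (a, \<alpha>) (h, k) = 0" "B (h, k) (b, \<beta>) = 0" for k
      using B h by (simp_all add: supported_def)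
    have ne: "a \<noteq> h" "b \<noteq> h" "r \<noteq> h" "c \<noteq> h" using a b h rc by auto
    have Fz: "?F (a, \<alpha>) (h, k) = - edge r h z Q (a, \<alpha>) (h, k)"
      "?F (h, k) (b, \<beta>) = - edge h c z' Q' (h, k) (b, \<beta>)" for k
      using ne by (simp_all add: edge_def Bz)
    have T: "sum f ?T = (\<Sum>k<d. f (h, k))" for f :: "nat \<times> nat \<Rightarrow> 'k gpoly"
      by (simp add: sum.cartesian_product')
    have "(\<Sum>k\<in>?T. ?F (a, \<alpha>) k * ?F k (b, \<beta>)) = (\<Sum>k<d. ?F (a, \<alpha>) (h, k) * ?F (h, k) (b, \<beta>))"
      by (rule T)
    also have "\<dots> = (\<Sum>k<d. edge r h z Q (a, \<alpha>) (h, k) * edge h c z' Q' (h, k) (b, \<beta>))"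
      by (simp only: Fz minus_mult_minus)
    also have "\<dots> = edge r c (z * z') (Q * Q') (a, \<alpha>) (b, \<beta>)"
    proof (cases "a = r \<and> b = c")
      case True
      have "(\<Sum>k<d. z * gconst (Q $$ (\<alpha>, k)) * (z' * gconst (Q' $$ (k, \<beta>))))
          = z * z' * (\<Sum>k<d. gconst (Q $$ (\<alpha>, k) * Q' $$ (k, \<beta>)))"
        by (simp add: sum_distrib_left gconst_mult mult_ac)
      also have "(\<Sum>k<d. gconst (Q $$ (\<alpha>, k) * Q' $$ (k, \<beta>)))
          = gconst (\<Sum>k<d. Q $$ (\<alpha>, k) * Q' $$ (k, \<beta>))"
        by (rule comm_monoid_add_hom.hom_sum[symmetric])
           (unfold_locales, auto simp: gconst_add)
      also have "(\<Sum>k<d. Q $$ (\<alpha>, k) * Q' $$ (k, \<beta>)) = (Q * Q') $$ (\<alpha>, \<beta>)"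
        using Q a b by (auto simp: scalar_prod_def atLeast0LessThan intro!: sum.cong)
      finally show ?thesis using True by (simp add: edge_def)
    qed (auto simp: edge_def)
    finally have "(\<Sum>k\<in>?T. ?F (a, \<alpha>) k * ?F k (b, \<beta>)) = edge r c (z * z') (Q * Q') (a, \<alpha>) (b, \<beta>)" .
    moreover have "?F (a, \<alpha>) (b, \<beta>) = of_bool ((a, \<alpha>) = (b, \<beta>)) - B (a, \<alpha>) (b, \<beta>)"
      using ne by (simp add: edge_def)
    ultimately show ?thesis
      by (simp only: diff_diff_eq)
  qed
  have "insert h V \<times> {..<d} = V \<times> {..<d} \<union> ?T" by auto
  then have "pdet (insert h V) (\<lambda>\<rho> \<sigma>. B \<rho> \<sigma> + edge h c z' Q' \<rho> \<sigma> + edge r h z Q \<rho> \<sigma>)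
      = fdet (V \<times> {..<d} \<union> ?T) ?F"
    by (simp only: pdet_def)
  also have "\<dots> = fdet (V \<times> {..<d}) (\<lambda>i j. ?F i j - (\<Sum>k\<in>?T. ?F i k * ?F k j))"
  proof (rule fdet_eliminate)
    show "?F i j = (if i = j then 1 else 0)" if "i \<in> ?T" "j \<in> ?T" for i j
      using that h rc B by (auto simp: supported_def edge_def)
  qed (use fin h in auto)
  also have "\<dots> = pdet V (\<lambda>\<rho> \<sigma>. B \<rho> \<sigma> + edge r c (z * z') (Q * Q') \<rho> \<sigma>)"
    unfolding pdet_def using * by (intro fdet_cong) blast
  finally show ?thesis .
qed

text \<open>Adding \<open>z s^k Q\<close> to the label of an edge can be simulated, on \<open>q\<close> more nodes, by a tuple \<open>\<Xi>\<close>.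
  The factor \<open>s^k\<close> is the price for \<open>\<Xi>\<close> to vanish under substitutions killing \<open>z\<close> and \<open>s\<close>;
  without it the inner edges of the simulating paths would be constants.\<close>

definition realizes :: "nat \<Rightarrow> nat \<Rightarrow> 'k mat \<Rightarrow> bool"
  where "realizes q k Q \<longleftrightarrow> (\<forall>V G r c z s.
    finite V \<longrightarrow> finite G \<longrightarrow> V \<inter> G = {} \<longrightarrow> card G = q \<longrightarrow> r \<in> V \<longrightarrow> c \<in> V \<longrightarrow>
    (\<exists>\<Xi>. supported_tuple (V \<union> G) \<Xi> \<and> vanishes_with {z, s} \<Xi> \<and>
      (\<forall>B. supported V B \<longrightarrow>
        pdet (V \<union> G) (\<lambda>\<rho> \<sigma>. B \<rho> \<sigma> + lin \<Xi> \<rho> \<sigma>) =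
        pdet V (\<lambda>\<rho> \<sigma>. B \<rho> \<sigma> + edge r c (z * s ^ k) Q \<rho> \<sigma>))))"

lemma realizesE:
  assumes "realizes q k Q" "finite V" "finite G" "V \<inter> G = {}" "card G = q" "r \<in> V" "c \<in> V"
  obtains \<Xi> where "supported_tuple (V \<union> G) \<Xi>" "vanishes_with {z, s} \<Xi>"
    "\<And>B. supported V B \<Longrightarrow> pdet (V \<union> G) (\<lambda>\<rho> \<sigma>. B \<rho> \<sigma> + lin \<Xi> \<rho> \<sigma>) =
      pdet V (\<lambda>\<rho> \<sigma>. B \<rho> \<sigma> + edge r c (z * s ^ k) Q \<rho> \<sigma>)"
  using assms unfolding realizes_def by blast

text \<open>Surplus nodes stay isolated, and surplus powers of \<open>s\<close> are absorbed into
  \<open>z\<close>.\<close>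

lemma realizes_mono:
  assumes Q: "realizes q k Q" and le: "q \<le> q'" "k \<le> k'"
  shows "realizes q' k' Q"
  unfolding realizes_def
proof (intro allI impI)
  fix V G :: "nat set" and r c and z s :: "'k gpoly"
  assume VG: "finite V" "finite G" "V \<inter> G = {}" "card G = q'" "r \<in> V" "c \<in> V"
  obtain G0 where G0: "G0 \<subseteq> G" "card G0 = q"
    using le(1) VG(4) obtain_subset_with_card_n by metis
  have fin0: "finite G0" "V \<inter> G0 = {}" using G0 VG finite_subset by auto
  obtain \<Xi> where \<Xi>: "supported_tuple (V \<union> G0) \<Xi>" "vanishes_with {z * s ^ (k' - k), s} \<Xi>"
    "\<And>B. supported V B \<Longrightarrow> pdet (V \<union> G0) (\<lambda>\<rho> \<sigma>. B \<rho> \<sigma> + lin \<Xi> \<rho> \<sigma>) =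
      pdet V (\<lambda>\<rho> \<sigma>. B \<rho> \<sigma> + edge r c (z * s ^ (k' - k) * s ^ k) Q \<rho> \<sigma>)"
    by (rule realizesE[OF Q VG(1) fin0 G0(2) VG(5,6), of "z * s ^ (k' - k)" s]) auto
  have zs: "z * s ^ (k' - k) * s ^ k = z * s ^ k'"
    using le(2) by (simp add: mult.assoc flip: power_add)
  show "\<exists>\<Xi>. supported_tuple (V \<union> G) \<Xi> \<and> vanishes_with {z, s} \<Xi> \<and>
      (\<forall>B. supported V B \<longrightarrow>
        pdet (V \<union> G) (\<lambda>\<rho> \<sigma>. B \<rho> \<sigma> + lin \<Xi> \<rho> \<sigma>) =
        pdet V (\<lambda>\<rho> \<sigma>. B \<rho> \<sigma> + edge r c (z * s ^ k') Q \<rho> \<sigma>))"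
  proof (intro exI conjI allI impI)
    show "supported_tuple (V \<union> G) \<Xi>" using \<Xi>(1) G0 by (auto simp: supported_tuple_def)
    show "vanishes_with {z, s} \<Xi>"
      using \<Xi>(2) by (auto simp: vanishes_with_def gsubst.hom_mult)
    fix B :: "nat \<times> nat \<Rightarrow> nat \<times> nat \<Rightarrow> 'k gpoly" assume B: "supported V B"
    have "supported (V \<union> G0) (\<lambda>\<rho> \<sigma>. B \<rho> \<sigma> + lin \<Xi> \<rho> \<sigma>)"
      using B \<Xi>(1) by (intro supported_add supported_lin) (auto intro: supported_mono)
    then have "pdet (V \<union> G) (\<lambda>\<rho> \<sigma>. B \<rho> \<sigma> + lin \<Xi> \<rho> \<sigma>) = pdet (V \<union> G0) (\<lambda>\<rho> \<sigma>. B \<rho> \<sigma> + lin \<Xi> \<rho> \<sigma>)"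
      using VG G0 by (intro pdet_extend) auto
    then show "pdet (V \<union> G) (\<lambda>\<rho> \<sigma>. B \<rho> \<sigma> + lin \<Xi> \<rho> \<sigma>) =
        pdet V (\<lambda>\<rho> \<sigma>. B \<rho> \<sigma> + edge r c (z * s ^ k') Q \<rho> \<sigma>)"
      using \<Xi>(3)[OF B] by (simp only: zs)
  qed
qed

lemma realizes_generator:
  assumes j: "j < g"
  shows "realizes 0 0 (A j)"
  unfolding realizes_def
proof (intro allI impI)
  fix V G :: "nat set" and r c and z s :: "'k gpoly"
  assume VG: "finite V" "finite G" "V \<inter> G = {}" "card G = 0" "r \<in> V" "c \<in> V"
  let ?\<Xi> = "\<lambda>j' r' c'. if j' = j \<and> r' = r \<and> c' = c then z else 0"
  have lin: "lin ?\<Xi> \<rho> \<sigma> = edge r c (z * s ^ 0) (A j) \<rho> \<sigma>" for \<rho> \<sigma>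
  proof -
    have "lin ?\<Xi> \<rho> \<sigma> = (\<Sum>j'<g. if j' = j then edge r c z (A j) \<rho> \<sigma> else 0)"
      unfolding lin_def edge_def by (intro sum.cong) (auto simp: mult.commute)
    then show ?thesis using j by simp
  qed
  show "\<exists>\<Xi>. supported_tuple (V \<union> G) \<Xi> \<and> vanishes_with {z, s} \<Xi> \<and>
      (\<forall>B. supported V B \<longrightarrow>
        pdet (V \<union> G) (\<lambda>\<rho> \<sigma>. B \<rho> \<sigma> + lin \<Xi> \<rho> \<sigma>) =
        pdet V (\<lambda>\<rho> \<sigma>. B \<rho> \<sigma> + edge r c (z * s ^ 0) (A j) \<rho> \<sigma>))"
    using VG lin
    by (intro exI[of _ ?\<Xi>]) (auto simp: supported_tuple_def vanishes_with_def)
qed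

lemma realizes_zero: "realizes 0 0 (0\<^sub>m d d)"
  unfolding realizes_def
proof (intro allI impI)
  fix V G :: "nat set" and r c and z s :: "'k gpoly"
  assume VG: "finite V" "finite G" "V \<inter> G = {}" "card G = 0" "r \<in> V" "c \<in> V"
  show "\<exists>\<Xi>. supported_tuple (V \<union> G) \<Xi> \<and> vanishes_with {z, s} \<Xi> \<and>
      (\<forall>B. supported V B \<longrightarrow>
        pdet (V \<union> G) (\<lambda>\<rho> \<sigma>. B \<rho> \<sigma> + lin \<Xi> \<rho> \<sigma>) =
        pdet V (\<lambda>\<rho> \<sigma>. B \<rho> \<sigma> + edge r c (z * s ^ 0) (0\<^sub>m d d) \<rho> \<sigma>))"
    using VG
    by (intro exI[of _ "\<lambda>_ _ _. 0"])
      (auto simp: supported_tuple_def vanishes_with_def lin_def edge_def intro!: pdet_cong)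
qed

text \<open>The scalar is absorbed into \<open>z\<close>.\<close>

lemma realizes_smult:
  assumes Q: "realizes q k Q" "Q \<in> carrier_mat d d"
  shows "realizes q k (a \<cdot>\<^sub>m Q)"
  unfolding realizes_def
proof (intro allI impI)
  fix V G :: "nat set" and r c and z s :: "'k gpoly"
  assume VG: "finite V" "finite G" "V \<inter> G = {}" "card G = q" "r \<in> V" "c \<in> V"
  obtain \<Xi> where \<Xi>: "supported_tuple (V \<union> G) \<Xi>" "vanishes_with {gconst a * z, s} \<Xi>"
    "\<And>B. supported V B \<Longrightarrow> pdet (V \<union> G) (\<lambda>\<rho> \<sigma>. B \<rho> \<sigma> + lin \<Xi> \<rho> \<sigma>) =
      pdet V (\<lambda>\<rho> \<sigma>. B \<rho> \<sigma> + edge r c (gconst a * z * s ^ k) Q \<rho> \<sigma>)"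
    by (rule realizesE[OF Q(1) VG, of "gconst a * z" s]) auto
  have "pdet V (\<lambda>\<rho> \<sigma>. B \<rho> \<sigma> + edge r c (gconst a * z * s ^ k) Q \<rho> \<sigma>)
      = pdet V (\<lambda>\<rho> \<sigma>. B \<rho> \<sigma> + edge r c (z * s ^ k) (a \<cdot>\<^sub>m Q) \<rho> \<sigma>)" for B
    using Q(2) by (intro pdet_cong) (auto simp: edge_def gconst_mult)
  then show "\<exists>\<Xi>. supported_tuple (V \<union> G) \<Xi> \<and> vanishes_with {z, s} \<Xi> \<and>
      (\<forall>B. supported V B \<longrightarrow>
        pdet (V \<union> G) (\<lambda>\<rho> \<sigma>. B \<rho> \<sigma> + lin \<Xi> \<rho> \<sigma>) =
        pdet V (\<lambda>\<rho> \<sigma>. B \<rho> \<sigma> + edge r c (z * s ^ k) (a \<cdot>\<^sub>m Q) \<rho> \<sigma>))"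
    using \<Xi> by (intro exI[of _ \<Xi>]) (auto simp: vanishes_with_def gsubst.hom_mult)
qed

lemma vanishes_with_add:
  "vanishes_with Z \<Xi> \<Longrightarrow> vanishes_with Z \<Xi>' \<Longrightarrow> vanishes_with Z (\<lambda>j r c. \<Xi> j r c + \<Xi>' j r c)"
  by (auto simp: vanishes_with_def gsubst.hom_add)

lemma split_card:
  assumes "finite G" "card G = a + b"
  obtains G1 G2 where "G = G1 \<union> G2" "G1 \<inter> G2 = {}" "card G1 = a" "card G2 = b"
    "finite G1" "finite G2"
proof -
  obtain G1 where G1: "G1 \<subseteq> G" "card G1 = a"
    using assms by (metis le_add1 obtain_subset_with_card_n)
  have "finite G1" using G1 assms finite_subset by blast
  show ?thesis
    by (rule that[of G1 "G - G1"]) (use G1 assms \<open>finite G1\<close> in \<open>auto simp: card_Diff_subset\<close>)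
qed

text \<open>Two simulations of parallel edges are placed on disjoint sets of extra nodes. The one on
  \<open>G2\<close> is built over \<open>V \<union> G1\<close>, so it can be removed first, with the
  other one treated as part of \<open>B\<close>.\<close>

lemma realizes_add:
  assumes Q: "realizes q k Q" "Q \<in> carrier_mat d d" and Q': "realizes q' k Q'" "Q' \<in> carrier_mat d d"
  shows "realizes (q + q') k (Q + Q')"
  unfolding realizes_def
proof (intro allI impI)
  fix V G :: "nat set" and r c and z s :: "'k gpoly"
  assume VG: "finite V" "finite G" "V \<inter> G = {}" "card G = q + q'" "r \<in> V" "c \<in> V"
  obtain G1 G2 where G: "G = G1 \<union> G2" "G1 \<inter> G2 = {}" "card G1 = q" "card G2 = q'"
    "finite G1" "finite G2" using split_card[OF VG(2,4)] .
  obtain \<Xi> where \<Xi>: "supported_tuple (V \<union> G1) \<Xi>" "vanishes_with {z, s} \<Xi>"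
    "\<And>B. supported V B \<Longrightarrow> pdet (V \<union> G1) (\<lambda>\<rho> \<sigma>. B \<rho> \<sigma> + lin \<Xi> \<rho> \<sigma>) =
      pdet V (\<lambda>\<rho> \<sigma>. B \<rho> \<sigma> + edge r c (z * s ^ k) Q \<rho> \<sigma>)"
    by (rule realizesE[OF Q(1), of V G1 r c z s]) (use VG G in auto)
  obtain \<Xi>' where \<Xi>': "supported_tuple (V \<union> G1 \<union> G2) \<Xi>'" "vanishes_with {z, s} \<Xi>'"
    "\<And>B. supported (V \<union> G1) B \<Longrightarrow> pdet (V \<union> G1 \<union> G2) (\<lambda>\<rho> \<sigma>. B \<rho> \<sigma> + lin \<Xi>' \<rho> \<sigma>) =
      pdet (V \<union> G1) (\<lambda>\<rho> \<sigma>. B \<rho> \<sigma> + edge r c (z * s ^ k) Q' \<rho> \<sigma>)"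
  proof (rule realizesE[OF Q'(1), of "V \<union> G1" G2 r c z s])
    show "(V \<union> G1) \<inter> G2 = {}" using VG G by auto
  qed (use VG G in auto)
  show "\<exists>\<Xi>. supported_tuple (V \<union> G) \<Xi> \<and> vanishes_with {z, s} \<Xi> \<and>
      (\<forall>B. supported V B \<longrightarrow>
        pdet (V \<union> G) (\<lambda>\<rho> \<sigma>. B \<rho> \<sigma> + lin \<Xi> \<rho> \<sigma>) =
        pdet V (\<lambda>\<rho> \<sigma>. B \<rho> \<sigma> + edge r c (z * s ^ k) (Q + Q') \<rho> \<sigma>))"
  proof (intro exI[of _ "\<lambda>j r c. \<Xi> j r c + \<Xi>' j r c"] conjI allI impI)
    show "supported_tuple (V \<union> G) (\<lambda>j r c. \<Xi> j r c + \<Xi>' j r c)"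
      using \<Xi>(1) \<Xi>'(1) G by (auto simp: supported_tuple_def)
    show "vanishes_with {z, s} (\<lambda>j r c. \<Xi> j r c + \<Xi>' j r c)"
      by (intro vanishes_with_add \<Xi> \<Xi>')
    fix B :: "nat \<times> nat \<Rightarrow> nat \<times> nat \<Rightarrow> 'k gpoly" assume B: "supported V B"
    have 1: "supported (V \<union> G1) (\<lambda>\<rho> \<sigma>. B \<rho> \<sigma> + lin \<Xi> \<rho> \<sigma>)"
      using B \<Xi>(1) by (intro supported_add supported_lin) (auto intro: supported_mono)
    have 2: "supported V (\<lambda>\<rho> \<sigma>. B \<rho> \<sigma> + edge r c (z * s ^ k) Q' \<rho> \<sigma>)"
      using B VG by (intro supported_add supported_edge)
    have "pdet (V \<union> G) (\<lambda>\<rho> \<sigma>. B \<rho> \<sigma> + lin (\<lambda>j r c. \<Xi> j r c + \<Xi>' j r c) \<rho> \<sigma>)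
        = pdet (V \<union> G1 \<union> G2) (\<lambda>\<rho> \<sigma>. (B \<rho> \<sigma> + lin \<Xi> \<rho> \<sigma>) + lin \<Xi>' \<rho> \<sigma>)"
      by (simp add: lin_add G(1) Un_assoc add.assoc)
    also have "\<dots> = pdet (V \<union> G1) (\<lambda>\<rho> \<sigma>. (B \<rho> \<sigma> + edge r c (z * s ^ k) Q' \<rho> \<sigma>) + lin \<Xi> \<rho> \<sigma>)"
      unfolding \<Xi>'(3)[OF 1] by (simp add: add.assoc add.commute add.left_commute)
    also have "\<dots> = pdet V (\<lambda>\<rho> \<sigma>. B \<rho> \<sigma> + edge r c (z * s ^ k) Q' \<rho> \<sigma> + edge r c (z * s ^ k) Q \<rho> \<sigma>)"
      by (rule \<Xi>(3)[OF 2])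
    also have "\<dots> = pdet V (\<lambda>\<rho> \<sigma>. B \<rho> \<sigma> + edge r c (z * s ^ k) (Q + Q') \<rho> \<sigma>)"
      using Q(2) Q'(2) by (intro pdet_cong) (auto simp: edge_def gconst_add algebra_simps)
    finally show "pdet (V \<union> G) (\<lambda>\<rho> \<sigma>. B \<rho> \<sigma> + lin (\<lambda>j r c. \<Xi> j r c + \<Xi>' j r c) \<rho> \<sigma>) =
        pdet V (\<lambda>\<rho> \<sigma>. B \<rho> \<sigma> + edge r c (z * s ^ k) (Q + Q') \<rho> \<sigma>)" .
  qed
qed

text \<open>One extra node \<open>h\<close> carries a path from \<open>r\<close> to \<open>c\<close>
  whose two edges are labelled by multiples of \<open>Q\<close> and \<open>Q'\<close>; both edges
  are simulated on further nodes. Removing \<open>G2\<close>, \<open>G1\<close> and \<open>h\<close>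
  in this order leaves the product.\<close>

lemma realizes_mult:
  assumes Q: "realizes q k Q" "Q \<in> carrier_mat d d" and Q': "realizes q' k' Q'" "Q' \<in> carrier_mat d d"
  shows "realizes (1 + (q + q')) (k + Suc k') (Q * Q')"
  unfolding realizes_def
proof (intro allI impI)
  fix V G :: "nat set" and r c and z s :: "'k gpoly"
  assume VG: "finite V" "finite G" "V \<inter> G = {}" "card G = 1 + (q + q')" "r \<in> V" "c \<in> V"
  obtain H G12 where H: "G = H \<union> G12" "H \<inter> G12 = {}" "card H = 1" "card G12 = q + q'"
    "finite G12" using split_card[OF VG(2,4)] .
  obtain h where h: "H = {h}" using H(3) card_1_singletonE by blast
  obtain G1 G2 where G: "G12 = G1 \<union> G2" "G1 \<inter> G2 = {}" "card G1 = q" "card G2 = q'"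
    "finite G1" "finite G2" using split_card[OF H(5,4)] .
  let ?V = "insert h V"
  obtain \<Xi> where \<Xi>: "supported_tuple (?V \<union> G1) \<Xi>" "vanishes_with {z, s} \<Xi>"
    "\<And>B. supported ?V B \<Longrightarrow> pdet (?V \<union> G1) (\<lambda>\<rho> \<sigma>. B \<rho> \<sigma> + lin \<Xi> \<rho> \<sigma>) =
      pdet ?V (\<lambda>\<rho> \<sigma>. B \<rho> \<sigma> + edge r h (z * s ^ k) Q \<rho> \<sigma>)"
  proof (rule realizesE[OF Q(1), of ?V G1 r h z s])
    show "?V \<inter> G1 = {}" using VG G H h by auto
  qed (use VG G in auto)
  \<comment> \<open>The second edge takes \<open>s\<close> in the place of \<open>z\<close>. The
    value 1 there would give the right product but entries that need not vanish with
    \<open>z\<close> and \<open>s\<close>; this accounts for the \<open>Suc\<close> in the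
    exponent.\<close>
  obtain \<Xi>' where \<Xi>': "supported_tuple (?V \<union> G1 \<union> G2) \<Xi>'" "vanishes_with {s, s} \<Xi>'"
    "\<And>B. supported (?V \<union> G1) B \<Longrightarrow> pdet (?V \<union> G1 \<union> G2) (\<lambda>\<rho> \<sigma>. B \<rho> \<sigma> + lin \<Xi>' \<rho> \<sigma>) =
      pdet (?V \<union> G1) (\<lambda>\<rho> \<sigma>. B \<rho> \<sigma> + edge h c (s * s ^ k') Q' \<rho> \<sigma>)"
  proof (rule realizesE[OF Q'(1), of "?V \<union> G1" G2 h c s s])
    show "(?V \<union> G1) \<inter> G2 = {}" using VG G H h by auto
  qed (use VG G in auto)
  have VG': "V \<union> G = ?V \<union> G1 \<union> G2" using H(1) h G(1) by auto
  have zs: "z * s ^ k * (s * s ^ k') = z * s ^ (k + Suc k')"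
    by (simp add: power_add mult_ac)
  have hV: "h \<notin> V" using VG H h by auto
  show "\<exists>\<Xi>. supported_tuple (V \<union> G) \<Xi> \<and> vanishes_with {z, s} \<Xi> \<and>
      (\<forall>B. supported V B \<longrightarrow>
        pdet (V \<union> G) (\<lambda>\<rho> \<sigma>. B \<rho> \<sigma> + lin \<Xi> \<rho> \<sigma>) =
        pdet V (\<lambda>\<rho> \<sigma>. B \<rho> \<sigma> + edge r c (z * s ^ (k + Suc k')) (Q * Q') \<rho> \<sigma>))"
  proof (intro exI[of _ "\<lambda>j r c. \<Xi> j r c + \<Xi>' j r c"] conjI allI impI)
    show "supported_tuple (V \<union> G) (\<lambda>j r c. \<Xi> j r c + \<Xi>' j r c)"
      using \<Xi>(1) \<Xi>'(1) unfolding VG' by (auto simp: supported_tuple_def)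
    have "vanishes_with {z, s} \<Xi>'" using \<Xi>'(2) by (auto simp: vanishes_with_def)
    then show "vanishes_with {z, s} (\<lambda>j r c. \<Xi> j r c + \<Xi>' j r c)"
      by (intro vanishes_with_add \<Xi>)
    fix B :: "nat \<times> nat \<Rightarrow> nat \<times> nat \<Rightarrow> 'k gpoly" assume B: "supported V B"
    have 1: "supported (?V \<union> G1) (\<lambda>\<rho> \<sigma>. B \<rho> \<sigma> + lin \<Xi> \<rho> \<sigma>)"
      using B \<Xi>(1) by (intro supported_add supported_lin) (auto intro: supported_mono)
    have 2: "supported ?V (\<lambda>\<rho> \<sigma>. B \<rho> \<sigma> + edge h c (s * s ^ k') Q' \<rho> \<sigma>)"
      using B VG by (intro supported_add supported_edge) (auto intro: supported_mono)
    have "pdet (V \<union> G) (\<lambda>\<rho> \<sigma>. B \<rho> \<sigma> + lin (\<lambda>j r c. \<Xi> j r c + \<Xi>' j r c) \<rho> \<sigma>)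
        = pdet (?V \<union> G1 \<union> G2) (\<lambda>\<rho> \<sigma>. (B \<rho> \<sigma> + lin \<Xi> \<rho> \<sigma>) + lin \<Xi>' \<rho> \<sigma>)"
      unfolding VG' by (simp add: lin_add add.assoc)
    also have "\<dots> = pdet (?V \<union> G1) (\<lambda>\<rho> \<sigma>. (B \<rho> \<sigma> + edge h c (s * s ^ k') Q' \<rho> \<sigma>) + lin \<Xi> \<rho> \<sigma>)"
      unfolding \<Xi>'(3)[OF 1] by (simp add: add.assoc add.commute add.left_commute)
    also have "\<dots> = pdet ?V (\<lambda>\<rho> \<sigma>. B \<rho> \<sigma> + edge h c (s * s ^ k') Q' \<rho> \<sigma> + edge r h (z * s ^ k) Q \<rho> \<sigma>)"
      by (rule \<Xi>(3)[OF 2])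
    also have "\<dots> = pdet V (\<lambda>\<rho> \<sigma>. B \<rho> \<sigma> + edge r c (z * s ^ k * (s * s ^ k')) (Q * Q') \<rho> \<sigma>)"
      by (rule pdet_path) (use VG hV B Q Q' in auto)
    finally show "pdet (V \<union> G) (\<lambda>\<rho> \<sigma>. B \<rho> \<sigma> + lin (\<lambda>j r c. \<Xi> j r c + \<Xi>' j r c) \<rho> \<sigma>) =
        pdet V (\<lambda>\<rho> \<sigma>. B \<rho> \<sigma> + edge r c (z * s ^ (k + Suc k')) (Q * Q') \<rho> \<sigma>)"
      by (simp only: zs)
  qed
qed

lemma realizes_algebra:
  assumes "Q \<in> mat_algebra_gen d (A ` {..<g})"
  shows "Q \<in> carrier_mat d d \<and> (\<exists>q k. realizes q k Q)"
  using assms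
proof induction
  case (gen Q)
  then show ?case using A_carrier realizes_generator by auto
next
  case zero
  then show ?case using realizes_zero by auto
next
  case (add Q Q')
  then obtain q k q' k' where *: "realizes q k Q" "realizes q' k' Q'" by auto
  \<comment> \<open>The sum needs a common power of \<open>s\<close> as coefficient of both
    summands.\<close>
  have "realizes q (max k k') Q" "realizes q' (max k k') Q'"
    using *[THEN realizes_mono] by auto
  then have "realizes (q + q') (max k k') (Q + Q')" using add by (intro realizes_add) auto
  then show ?case using add by auto
next
  case (smult Q c)
  then obtain q k where "realizes q k Q" by auto
  with smult have "realizes q k (c \<cdot>\<^sub>m Q)" by (intro realizes_smult) auto
  with smult show ?case by auto
next
  case (mult Q Q')
  then obtain q k q' k' where "realizes q k Q" "realizes q' k' Q'" by auto
  with mult have "realizes (1 + (q + q')) (k + Suc k') (Q * Q')" by (intro realizes_mult) auto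
  with mult show ?case by auto
qed

lemma realizes_uniform:
  assumes "finite T" "\<And>Q. Q \<in> T \<Longrightarrow> \<exists>q k. realizes q k Q"
  shows "\<exists>q k. \<forall>Q\<in>T. realizes q k Q"
  using assms
proof (induction T rule: finite_induct)
  case (insert Q T)
  then have "\<exists>q k. \<forall>Q\<in>T. realizes q k Q" by auto
  then obtain q k where T: "\<And>Q. Q \<in> T \<Longrightarrow> realizes q k Q" by auto
  obtain q' k' where Q: "realizes q' k' Q" using insert.prems[of Q] by auto
  have "realizes (max q q') (max k k') Q'" if "Q' \<in> insert Q T" for Q'
    using that realizes_mono[OF T, of Q'] realizes_mono[OF Q] by auto
  then show ?case by auto
qed auto

section \<open>Matrix units and generic blocks\<close>

definition unit_mat :: "nat \<Rightarrow> nat \<Rightarrow> 'k mat"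
  where "unit_mat \<alpha> \<beta> = mat d d (\<lambda>(i, j). of_bool (i = \<alpha> \<and> j = \<beta>))"

text \<open>This is where irreducibility of the pencil enters: the matrix units lie in the generated
  algebra. As there are finitely many of them, \<open>q\<close> and \<open>k\<close> can be chosen
  uniformly.\<close>

lemma realizes_units:
  assumes "irreducible_pencil d g A"
  obtains q k where "\<And>\<alpha> \<beta>. \<alpha> < d \<Longrightarrow> \<beta> < d \<Longrightarrow> realizes q k (unit_mat \<alpha> \<beta>)"
proof -
  have "\<exists>q k. \<forall>Q\<in>(\<lambda>(\<alpha>, \<beta>). unit_mat \<alpha> \<beta>) ` ({..<d} \<times> {..<d}). realizes q k Q"
    using assms realizes_algebra
    by (intro realizes_uniform) (auto simp: irreducible_pencil_def unit_mat_def)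
  then obtain q k where "\<forall>Q\<in>(\<lambda>(\<alpha>, \<beta>). unit_mat \<alpha> \<beta>) ` ({..<d} \<times> {..<d}). realizes q k Q"
    by auto
  then show ?thesis by (intro that[of q k]) auto
qed

text \<open>Each entry in \<open>S\<close> is the entry of a matrix unit on some edge and gets its
  own \<open>q\<close> extra nodes, so the coefficients can be prescribed independently.\<close>

lemma realizes_block:
  assumes units: "\<And>\<alpha> \<beta>. \<alpha> < d \<Longrightarrow> \<beta> < d \<Longrightarrow> realizes q k (unit_mat \<alpha> \<beta>)"
    and V: "finite V"
    and S: "finite S" "S \<subseteq> (V \<times> {..<d}) \<times> (V \<times> {..<d})"
    and G: "finite G" "V \<inter> G = {}" "card G = q * card S"
  shows "\<exists>\<Xi>. supported_tuple (V \<union> G) \<Xi> \<and> vanishes_with (insert s (range Z)) \<Xi> \<and>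
      (\<forall>B. supported V B \<longrightarrow>
        pdet (V \<union> G) (\<lambda>\<rho> \<sigma>. B \<rho> \<sigma> + lin \<Xi> \<rho> \<sigma>) =
        pdet V (\<lambda>\<rho> \<sigma>. B \<rho> \<sigma> + (if (\<rho>, \<sigma>) \<in> S then Z (\<rho>, \<sigma>) * s ^ k else 0)))"
  using S G
proof (induction S arbitrary: G rule: finite_induct)
  case empty
  then show ?case
    by (intro exI[of _ "\<lambda>_ _ _. 0"]) (auto simp: supported_tuple_def vanishes_with_def lin_def)
next
  case (insert e S)
  obtain r \<alpha> c \<beta> where e: "e = ((r, \<alpha>), (c, \<beta>))" by (metis prod.collapse)
  have e': "r \<in> V" "c \<in> V" "\<alpha> < d" "\<beta> < d" and S: "S \<subseteq> (V \<times> {..<d}) \<times> (V \<times> {..<d})"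
    using insert.prems(1) by (auto simp: e)
  have "card G = q + q * card S" using insert by simp
  from split_card[OF insert.prems(2) this] obtain G2 G1
    where G: "G = G2 \<union> G1" "G2 \<inter> G1 = {}" "card G2 = q" "card G1 = q * card S"
      "finite G1" "finite G2" by metis
  have VG: "V \<inter> G1 = {}" "(V \<union> G1) \<inter> G2 = {}" using insert.prems G by auto
  obtain \<Xi> where \<Xi>: "supported_tuple (V \<union> G1) \<Xi>" "vanishes_with (insert s (range Z)) \<Xi>"
    "\<And>B. supported V B \<Longrightarrow> pdet (V \<union> G1) (\<lambda>\<rho> \<sigma>. B \<rho> \<sigma> + lin \<Xi> \<rho> \<sigma>) =
      pdet V (\<lambda>\<rho> \<sigma>. B \<rho> \<sigma> + (if (\<rho>, \<sigma>) \<in> S then Z (\<rho>, \<sigma>) * s ^ k else 0))"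
    using insert.IH[OF S G(5) VG(1) G(4)] by blast
  obtain \<Xi>' where \<Xi>': "supported_tuple (V \<union> G1 \<union> G2) \<Xi>'" "vanishes_with {Z e, s} \<Xi>'"
    "\<And>B. supported (V \<union> G1) B \<Longrightarrow> pdet (V \<union> G1 \<union> G2) (\<lambda>\<rho> \<sigma>. B \<rho> \<sigma> + lin \<Xi>' \<rho> \<sigma>) =
      pdet (V \<union> G1) (\<lambda>\<rho> \<sigma>. B \<rho> \<sigma> + edge r c (Z e * s ^ k) (unit_mat \<alpha> \<beta>) \<rho> \<sigma>)"
    by (rule realizesE[OF units, of \<alpha> \<beta> "V \<union> G1" G2 r c "Z e" s]) (use V G VG e' in auto)
  show ?case
  proof (intro exI[of _ "\<lambda>j r c. \<Xi> j r c + \<Xi>' j r c"] conjI allI impI)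
    show "supported_tuple (V \<union> G) (\<lambda>j r c. \<Xi> j r c + \<Xi>' j r c)"
      using \<Xi>(1) \<Xi>'(1) G(1) by (auto simp: supported_tuple_def)
    have "vanishes_with (insert s (range Z)) \<Xi>'"
      using \<Xi>'(2) unfolding vanishes_with_def by blast
    then show "vanishes_with (insert s (range Z)) (\<lambda>j r c. \<Xi> j r c + \<Xi>' j r c)"
      by (intro vanishes_with_add \<Xi>)
    fix B :: "nat \<times> nat \<Rightarrow> nat \<times> nat \<Rightarrow> 'k gpoly" assume B: "supported V B"
    have 1: "supported (V \<union> G1) (\<lambda>\<rho> \<sigma>. B \<rho> \<sigma> + lin \<Xi> \<rho> \<sigma>)"
      using B \<Xi>(1) by (intro supported_add supported_lin) (auto intro: supported_mono)
    have 2: "supported V (\<lambda>\<rho> \<sigma>. B \<rho> \<sigma> + edge r c (Z e * s ^ k) (unit_mat \<alpha> \<beta>) \<rho> \<sigma>)"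
      using B e' by (intro supported_add supported_edge)
    have "V \<union> G = V \<union> G1 \<union> G2" using G(1) by auto
    then have "pdet (V \<union> G) (\<lambda>\<rho> \<sigma>. B \<rho> \<sigma> + lin (\<lambda>j r c. \<Xi> j r c + \<Xi>' j r c) \<rho> \<sigma>)
        = pdet (V \<union> G1 \<union> G2) (\<lambda>\<rho> \<sigma>. (B \<rho> \<sigma> + lin \<Xi> \<rho> \<sigma>) + lin \<Xi>' \<rho> \<sigma>)"
      by (simp add: lin_add add.assoc)
    also have "\<dots> = pdet (V \<union> G1) (\<lambda>\<rho> \<sigma>. (B \<rho> \<sigma> + edge r c (Z e * s ^ k) (unit_mat \<alpha> \<beta>) \<rho> \<sigma>) + lin \<Xi> \<rho> \<sigma>)"
      unfolding \<Xi>'(3)[OF 1] by (simp add: add.assoc add.commute add.left_commute)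
    also have "\<dots> = pdet V (\<lambda>\<rho> \<sigma>. B \<rho> \<sigma> + edge r c (Z e * s ^ k) (unit_mat \<alpha> \<beta>) \<rho> \<sigma>
        + (if (\<rho>, \<sigma>) \<in> S then Z (\<rho>, \<sigma>) * s ^ k else 0))"
      by (rule \<Xi>(3)[OF 2])
    also have "\<dots> = pdet V (\<lambda>\<rho> \<sigma>. B \<rho> \<sigma> + (if (\<rho>, \<sigma>) \<in> insert e S then Z (\<rho>, \<sigma>) * s ^ k else 0))"
      using insert.hyps(2) by (intro pdet_cong) (auto simp: edge_def unit_mat_def e)
    finally show "pdet (V \<union> G) (\<lambda>\<rho> \<sigma>. B \<rho> \<sigma> + lin (\<lambda>j r c. \<Xi> j r c + \<Xi>' j r c) \<rho> \<sigma>)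
      = pdet V (\<lambda>\<rho> \<sigma>. B \<rho> \<sigma> + (if (\<rho>, \<sigma>) \<in> insert e S then Z (\<rho>, \<sigma>) * s ^ k else 0))" .
  qed
qed

end

section \<open>Determinants with a generic block\<close>

text \<open>The first component exceeds \<open>g\<close>, which separates the block variables from
  the variables of the pencil and from \<open>(g, 0, 0)\<close>; it encodes the positions inside the
  label, while the nodes take their usual places.\<close>

definition block_var :: "nat \<Rightarrow> (nat \<times> nat) \<times> (nat \<times> nat) \<Rightarrow> gindex"
  where "block_var g e = (Suc (g + prod_encode (snd (fst e), snd (snd e))), fst (fst e), fst (snd e))"

text \<open>A loop at a node of \<open>J\<close> counts twice. The weight is thus a row part plus a
  column part, as needed for \<open>wdeg_fdet_le\<close>.\<close>

definition touch :: "nat set \<Rightarrow> gindex \<Rightarrow> nat"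
  where "touch J v = of_bool (fst (snd v) \<in> J) + of_bool (snd (snd v) \<in> J)"

lemma block_var_inject [simp]: "block_var g e = block_var g e' \<longleftrightarrow> e = e'"
  by (auto simp: block_var_def prod_eq_iff)

lemma block_var_fst: "fst (block_var g e) > g"
  by (simp add: block_var_def)

lemma wdeg_one_minus_gvar: "wdeg w (1 - gvar v :: 'k::field gpoly) = w v"
proof (rule antisym)
  have "wdeg w (1 - (1 - gvar v) :: 'k gpoly) \<le> wdeg w (1 - gvar v :: 'k gpoly)"
    by (rule wdeg_diff_le) auto
  then show "w v \<le> wdeg w (1 - gvar v :: 'k gpoly)" by simp
qed (auto intro: wdeg_diff_le)

lemma wdeg_prod:
  fixes f :: "'i \<Rightarrow> 'k::field gpoly"
  assumes "\<And>i. i \<in> S \<Longrightarrow> f i \<noteq> 0"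
  shows "wdeg w (\<Prod>i\<in>S. f i) = (\<Sum>i\<in>S. wdeg w (f i))"
  using assms by (induction S rule: infinite_finite_induct) (auto simp: wdeg_mult)

lemma wdeg_pos: "m \<in> keys p \<Longrightarrow> v \<in> keys m \<Longrightarrow> w v \<noteq> 0 \<Longrightarrow> wdeg w p \<ge> 1"
  using wdeg_eq_0_iff[of w p] by (cases "wdeg w p") auto

lemma wdeg_mono: "(\<And>v. w v \<le> w' v) \<Longrightarrow> wdeg w p \<le> wdeg w' p"
  using wdeg_scale_le[of 1 w w' p] by simp

section \<open>Specializing the generic determinant to a generic block\<close>

context pencil
begin

definition gen_tuple :: "nat set \<Rightarrow> nat \<Rightarrow> nat \<Rightarrow> nat \<Rightarrow> 'k gpoly"
  where "gen_tuple V j r c = (if r \<in> V \<and> c \<in> V then gvar (j, r, c) else 0)"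

definition gdet :: "nat set \<Rightarrow> 'k gpoly"
  where "gdet V = pdet V (lin (gen_tuple V))"

definition vars :: "nat set \<Rightarrow> gindex set"
  where "vars V = {..<g} \<times> V \<times> V"

lemma supported_gen_tuple: "supported V (lin (gen_tuple V))"
  by (rule supported_lin) (auto simp: supported_tuple_def gen_tuple_def)

lemma lin_cong: "(\<And>j. j < g \<Longrightarrow> X j (fst \<rho>) (fst \<sigma>) = Y j (fst \<rho>) (fst \<sigma>)) \<Longrightarrow> lin X \<rho> \<sigma> = lin Y \<rho> \<sigma>"
  by (simp add: lin_def)

lemma gsubst_of_bool [simp]: "gsubst \<theta> (of_bool P) = of_bool P"
  by (cases P) auto

lemma gsubst_pdet: "gsubst \<theta> (pdet V B) = pdet V (\<lambda>\<rho> \<sigma>. gsubst \<theta> (B \<rho> \<sigma>))"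
  unfolding pdet_def
  by (subst fdet_hom[OF gsubst.comm_ring_hom_axioms]) (simp add: gsubst.hom_minus)

lemma gsubst_lin: "gsubst \<theta> (lin X \<rho> \<sigma>) = lin (\<lambda>j r c. gsubst \<theta> (X j r c)) \<rho> \<sigma>"
  by (simp add: lin_def gsubst.hom_sum gsubst.hom_mult)

text \<open>The restriction deletes all edges that meet nodes outside \<open>V\<close>, and isolated
  nodes do not contribute.\<close>

lemma grestrict_gdet:
  assumes "finite W" "V \<subseteq> W"
  shows "grestrict (vars V) (gdet W) = gdet V"
proof -
  have "grestrict (vars V) (gdet W) = pdet W (lin (gen_tuple V))"
    unfolding gdet_def grestrict_def gsubst_pdet gsubst_lin using assms(2)
    by (intro pdet_cong lin_cong) (auto simp: gen_tuple_def vars_def)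
  also have "\<dots> = pdet V (lin (gen_tuple V))"
    by (rule pdet_extend[OF assms supported_gen_tuple])
  finally show ?thesis by (simp add: gdet_def)
qed

lemma pdet_zero: "finite V \<Longrightarrow> pdet V (\<lambda>_ _. 0) = 1"
  unfolding pdet_def by (subst fdet_diagonal) auto

lemma gdet_nonzero: "finite V \<Longrightarrow> gdet V \<noteq> 0"
proof
  assume "finite V" "gdet V = 0"
  \<comment> \<open>The constant term is the determinant of the identity.\<close>
  then have "gsubst (\<lambda>_. 0) (gdet V) = 0" by simp
  moreover have "gsubst (\<lambda>_. 0) (gdet V) = pdet V (\<lambda>_ _. 0)"
    unfolding gdet_def gsubst_pdet gsubst_lin
    by (intro pdet_cong) (auto simp: lin_def gen_tuple_def intro!: sum.neutral)
  ultimately show False using pdet_zero[OF \<open>finite V\<close>] by simp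
qed

text \<open>The variable \<open>block_var g (\<rho>, \<sigma>)\<close> plays the entry at \<open>(\<rho>, \<sigma>)\<close> of a generic matrix on
  the rows and columns \<open>J \<times> {..<d}\<close>; \<open>(g, 0, 0)\<close> is one further variable.\<close>

definition block_det :: "nat \<Rightarrow> nat set \<Rightarrow> nat set \<Rightarrow> 'k gpoly"
  where "block_det k V J = pdet V (\<lambda>\<rho> \<sigma>. lin (gen_tuple V) \<rho> \<sigma> +
    (if (\<rho>, \<sigma>) \<in> (J \<times> {..<d}) \<times> (J \<times> {..<d}) then gvar (block_var g (\<rho>, \<sigma>)) * gvar (g, 0, 0) ^ k else 0))"

text \<open>A factorization of \<open>gdet (V \<union> G)\<close> becomes one of
  \<open>block_det k V J\<close>, while the restrictions of the factors to \<open>V\<close> stay the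
  same. The latter is the purpose of \<open>vanishes_with\<close>.\<close>

lemma block_specialization:
  assumes units: "\<And>\<alpha> \<beta>. \<alpha> < d \<Longrightarrow> \<beta> < d \<Longrightarrow> realizes q k (unit_mat \<alpha> \<beta>)"
    and V: "finite V" "J \<subseteq> V"
    and G: "finite G" "V \<inter> G = {}" "card G = q * (card J * d)\<^sup>2"
  obtains \<theta> where "gsubst \<theta> (gdet (V \<union> G)) = block_det k V J"
    "\<And>p. grestrict (vars V) (gsubst \<theta> p) = grestrict (vars V) p"
proof -
  let ?U = "J \<times> {..<d}"
  have fin: "finite J" using V finite_subset by blast
  have "card (?U \<times> ?U) = (card J * d)\<^sup>2"
    using fin by (simp add: card_cartesian_product power2_eq_square)
  then obtain \<Xi> where \<Xi>: "supported_tuple (V \<union> G) \<Xi>"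
    "vanishes_with (insert (gvar (g, 0, 0)) (range (\<lambda>e. gvar (block_var g e)))) \<Xi>"
    "\<And>B. supported V B \<Longrightarrow> pdet (V \<union> G) (\<lambda>\<rho> \<sigma>. B \<rho> \<sigma> + lin \<Xi> \<rho> \<sigma>) =
      pdet V (\<lambda>\<rho> \<sigma>. B \<rho> \<sigma> + (if (\<rho>, \<sigma>) \<in> ?U \<times> ?U then gvar (block_var g (\<rho>, \<sigma>)) * gvar (g, 0, 0) ^ k else 0))"
    using realizes_block[OF units V(1), of "?U \<times> ?U" G "gvar (g, 0, 0)" "\<lambda>e. gvar (block_var g e)"]
      fin V(2) G by auto
  \<comment> \<open>The polynomial \<open>p\<close> in the second claim is arbitrary. Its variables
    with \<open>j \<ge> g\<close> are killed by the restriction anyway, so they are sent to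
    0.\<close>
  let ?\<theta> = "\<lambda>(j, r, c). if j < g then gen_tuple V j r c + \<Xi> j r c else 0"
  have zero: "grestrict (vars V) (\<Xi> j r c) = 0" for j r c
  proof -
    have "block_var g e \<notin> vars V" for e
      using block_var_fst[of g e] by (cases "block_var g e") (auto simp: vars_def)
    then show ?thesis
      using \<Xi>(2) unfolding grestrict_def vanishes_with_def by (auto simp: vars_def)
  qed
  show ?thesis
  proof
    have "gsubst ?\<theta> (gdet (V \<union> G)) = pdet (V \<union> G) (lin (\<lambda>j r c. gen_tuple V j r c + \<Xi> j r c))"
      unfolding gdet_def gsubst_pdet gsubst_lin
      using \<Xi>(1) by (intro pdet_cong lin_cong) (auto simp: gen_tuple_def supported_tuple_def)
    also have "\<dots> = block_det k V J"
      unfolding lin_add[abs_def] block_det_def by (rule \<Xi>(3)[OF supported_gen_tuple])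
    finally show "gsubst ?\<theta> (gdet (V \<union> G)) = block_det k V J" .
    fix p :: "'k gpoly"
    have "grestrict (vars V) (?\<theta> v) = (if v \<in> vars V then gvar v else 0)" for v
    proof (cases v)
      case (fields j r c)
      show ?thesis
      proof (cases "j < g")
        case True
        then have "grestrict (vars V) (gen_tuple V j r c) = (if v \<in> vars V then gvar v else 0)"
          by (auto simp: grestrict_def gen_tuple_def vars_def fields)
        with True show ?thesis
          by (simp add: fields grestrict.hom_add zero)
      qed (simp add: fields vars_def)
    qed
    then show "grestrict (vars V) (gsubst ?\<theta> p) = grestrict (vars V) p"
      unfolding grestrict_def gsubst_gsubst by presburger
  qed
qed

lemma wdeg_block_det_le:
  assumes V: "finite V"
    and x: "\<And>j \<rho> \<sigma>. j < g \<Longrightarrow> \<rho> \<in> V \<times> {..<d} \<Longrightarrow> \<sigma> \<in> V \<times> {..<d} \<Longrightarrow> w (j, fst \<rho>, fst \<sigma>) \<le> r \<rho> + c \<sigma>"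
    and z: "\<And>\<rho> \<sigma>. \<rho> \<in> J \<times> {..<d} \<Longrightarrow> \<sigma> \<in> J \<times> {..<d} \<Longrightarrow> w (block_var g (\<rho>, \<sigma>)) \<le> r \<rho> + c \<sigma>"
    and s: "w (g, 0, 0) = 0"
  shows "wdeg w (block_det k V J) \<le> sum r (V \<times> {..<d}) + sum c (V \<times> {..<d})"
  unfolding block_det_def pdet_def
proof (rule wdeg_fdet_le)
  fix \<rho> \<sigma> assume \<rho>\<sigma>: "\<rho> \<in> V \<times> {..<d}" "\<sigma> \<in> V \<times> {..<d}"
  have "wdeg w (lin (gen_tuple V) \<rho> \<sigma>) \<le> r \<rho> + c \<sigma>"
    unfolding lin_def
  proof (rule wdeg_sum_le)
    fix j assume "j \<in> {..<g}"
    then have "wdeg w (gen_tuple V j (fst \<rho>) (fst \<sigma>)) \<le> r \<rho> + c \<sigma>"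
      using x[of j, OF _ \<rho>\<sigma>] by (simp add: gen_tuple_def)
    then show "wdeg w (gconst (A j $$ (snd \<rho>, snd \<sigma>)) * gen_tuple V j (fst \<rho>) (fst \<sigma>)) \<le> r \<rho> + c \<sigma>"
      using wdeg_mult_le[of w "gconst (A j $$ (snd \<rho>, snd \<sigma>))" "gen_tuple V j (fst \<rho>) (fst \<sigma>)"] by simp
  qed
  moreover have "wdeg w (gvar (block_var g (\<rho>, \<sigma>)) * gvar (g, 0, 0) ^ k :: 'k gpoly) \<le> r \<rho> + c \<sigma>"
    if "\<rho> \<in> J \<times> {..<d}" "\<sigma> \<in> J \<times> {..<d}"
    using z[OF that] wdeg_mult_le[of w "gvar (block_var g (\<rho>, \<sigma>)) :: 'k gpoly" "gvar (g, 0, 0) ^ k"]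
      wdeg_power_le[of w "gvar (g, 0, 0) :: 'k gpoly" k] s by simp
  ultimately show "wdeg w (of_bool (\<rho> = \<sigma>) - (lin (gen_tuple V) \<rho> \<sigma> +
      (if (\<rho>, \<sigma>) \<in> (J \<times> {..<d}) \<times> (J \<times> {..<d}) then gvar (block_var g (\<rho>, \<sigma>)) * gvar (g, 0, 0) ^ k else 0)))
      \<le> r \<rho> + c \<sigma>"
    by (intro wdeg_diff_le wdeg_add_le) auto
qed (use V in auto)

text \<open>Without pencil variables and with \<open>s = 1\<close>, only the identity minus the
  block remains, so lower bounds on degrees can be read off from simple choices of the
  block.\<close>

lemma gsubst_block_det:
  assumes "\<And>j r c. j < g \<Longrightarrow> \<theta> (j, r, c) = 0" "\<theta> (g, 0, 0) = 1"
  shows "gsubst \<theta> (block_det k V J) = fdet (V \<times> {..<d}) (\<lambda>\<rho> \<sigma>. of_bool (\<rho> = \<sigma>) -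
    (if (\<rho>, \<sigma>) \<in> (J \<times> {..<d}) \<times> (J \<times> {..<d}) then \<theta> (block_var g (\<rho>, \<sigma>)) else 0))"
proof -
  have "gsubst \<theta> (lin (gen_tuple V) \<rho> \<sigma>) = 0" for \<rho> \<sigma>
    unfolding gsubst_lin using assms(1) by (auto simp: lin_def gen_tuple_def intro!: sum.neutral)
  then show ?thesis
    unfolding block_det_def gsubst_pdet unfolding pdet_def
    by (intro fdet_cong) (auto simp: gsubst.hom_add gsubst.hom_mult gsubst.hom_power assms(2))
qed

lemma block_det_entry_occurs:
  assumes V: "finite V" "J \<subseteq> V" and \<rho>\<sigma>: "\<rho> \<in> J \<times> {..<d}" "\<sigma> \<in> J \<times> {..<d}"
  shows "wdeg (\<lambda>v. of_bool (v = block_var g (\<rho>, \<sigma>))) (block_det k V J) \<ge> 1"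
proof -
  let ?w = "\<lambda>v. of_bool (v = block_var g (\<rho>, \<sigma>)) :: nat"
  let ?z = "gvar (block_var g (\<rho>, \<sigma>)) :: 'k gpoly"
  \<comment> \<open>The block has the variable at \<open>(\<rho>, \<sigma>)\<close>, 1 at
    \<open>(\<sigma>, \<rho>)\<close> if this is a different position, and 0 elsewhere. In both
    cases the determinant is 1 minus the variable.\<close>
  define \<theta> where "\<theta> v = (if v = block_var g (\<rho>, \<sigma>) then ?z
    else if v = block_var g (\<sigma>, \<rho>) \<or> v = (g, 0, 0) then 1 else 0)" for v
  have ne: "block_var g e \<noteq> (j, r, c)" if "j \<le> g" for e j r c
    using block_var_fst[of g e] that by auto
  have \<theta>: "\<theta> (j, r, c) = 0" if "j < g" for j r c
    using that ne[of j, symmetric] by (simp add: \<theta>_def)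
  have \<theta>': "\<theta> (g, 0, 0) = 1"
    using ne[of g, symmetric] by (simp add: \<theta>_def)
  let ?F = "\<lambda>i j. of_bool (i = j) -
    (if (i, j) \<in> (J \<times> {..<d}) \<times> (J \<times> {..<d}) then \<theta> (block_var g (i, j)) else 0)"
  let ?T = "V \<times> {..<d} - {\<rho>}"
  have F: "?F i j = of_bool (i = j) - (if i = \<rho> \<and> j = \<sigma> then ?z else if i = \<sigma> \<and> j = \<rho> then 1 else 0)" for i j
    using \<rho>\<sigma> ne[of g] by (auto simp: \<theta>_def)
  have "{\<rho>} \<union> ?T = V \<times> {..<d}" using \<rho>\<sigma> V by auto
  moreover have "gsubst \<theta> (block_det k V J) = fdet (V \<times> {..<d}) ?F"
    by (rule gsubst_block_det) (use \<theta> \<theta>' in auto)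
  ultimately have "gsubst \<theta> (block_det k V J) = fdet ({\<rho>} \<union> ?T) ?F"
    by (simp only:)
  \<comment> \<open>Every entry that differs from the identity matrix lies in the row or column of
    \<open>\<rho>\<close>, so all other indices can be eliminated.\<close>
  also have "\<dots> = fdet {\<rho>} (\<lambda>i j. ?F i j - (\<Sum>l\<in>?T. ?F i l * ?F l j))"
    unfolding F using V by (intro fdet_eliminate) auto
  also have "\<dots> = 1 - ?z"
  proof (cases "\<rho> = \<sigma>")
    case True
    have "?F \<rho> l = 0" if "l \<in> ?T" for l
      unfolding F using that True by auto
    then show ?thesis unfolding fdet_singleton
      by (subst sum.neutral) (use F[of \<rho> \<rho>] True in auto)
  next
    case False
    have "(\<Sum>l\<in>?T. ?F \<rho> l * ?F l \<rho>) = (\<Sum>l\<in>?T. if l = \<sigma> then ?z else 0)"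
      unfolding F using False by (intro sum.cong) auto
    also have "\<dots> = ?z"
      using V \<rho>\<sigma> False by (subst sum.delta) auto
    finally show ?thesis unfolding fdet_singleton
      using F[of \<rho> \<rho>] False by simp
  qed
  finally have "wdeg ?w (gsubst \<theta> (block_det k V J)) = 1"
    by (simp add: wdeg_one_minus_gvar)
  moreover have "wdeg ?w (gsubst \<theta> (block_det k V J)) \<le> wdeg ?w (block_det k V J)"
    by (rule wdeg_gsubst_le) (auto simp: \<theta>_def)
  ultimately show ?thesis by simp
qed

lemma block_det_block_degree:
  assumes V: "finite V" "J \<subseteq> V"
  shows "wdeg (\<lambda>v. of_bool (v \<in> block_var g ` ((J \<times> {..<d}) \<times> (J \<times> {..<d})))) (block_det k V J) \<ge> card J * d"
proof -
  let ?U = "J \<times> {..<d}"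
  let ?w = "\<lambda>v. of_bool (v \<in> block_var g ` (?U \<times> ?U)) :: nat"
  \<comment> \<open>A diagonal block with independent variables: the determinant is a product of
    \<open>card J * d\<close> factors of the form 1 minus a variable.\<close>
  define \<theta> where "\<theta> v = (if v \<in> block_var g ` (\<lambda>\<rho>. (\<rho>, \<rho>)) ` ?U then gvar v
    else if v = (g, 0, 0) then 1 else (0 :: 'k gpoly))" for v
  have ne: "block_var g e \<noteq> (j, r, c)" if "j \<le> g" for e j r c
    using block_var_fst[of g e] that by auto
  have \<theta>: "\<theta> (j, r, c) = 0" if "j < g" for j r c
    using that ne[of j, symmetric] by (auto simp: \<theta>_def)
  have \<theta>': "\<theta> (g, 0, 0) = 1"
    using ne[of g, symmetric] by (auto simp: \<theta>_def)
  let ?F = "\<lambda>i j. of_bool (i = j) - (if (i, j) \<in> ?U \<times> ?U then \<theta> (block_var g (i, j)) else 0)"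
  have F: "?F i j = (if i = j then if i \<in> ?U then 1 - gvar (block_var g (i, i)) else 1 else 0)" for i j
    using ne[of g] by (auto simp: \<theta>_def image_iff)
  have nz: "gvar v \<noteq> (1 :: 'k gpoly)" for v
    using wdeg_one_minus_gvar[of "\<lambda>_. 1" v, where 'k = 'k] by auto
  note nz = nz nz[symmetric]
  have "gsubst \<theta> (block_det k V J) = (\<Prod>i\<in>V \<times> {..<d}. ?F i i)"
  proof -
    have "gsubst \<theta> (block_det k V J) = fdet (V \<times> {..<d}) ?F"
      by (rule gsubst_block_det) (use \<theta> \<theta>' in auto)
    also have "\<dots> = (\<Prod>i\<in>V \<times> {..<d}. ?F i i)"
      unfolding F using V by (intro fdet_diagonal) auto
    finally show ?thesis .
  qed
  also have "wdeg ?w \<dots> = (\<Sum>i\<in>V \<times> {..<d}. wdeg ?w (?F i i))"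
    unfolding F by (rule wdeg_prod) (auto simp: nz)
  also have "\<dots> = (\<Sum>i\<in>V \<times> {..<d}. of_bool (i \<in> ?U))"
    unfolding F by (intro sum.cong) (auto simp: wdeg_one_minus_gvar)
  also have "\<dots> = card ?U"
    using V by (subst sum_of_bool_eq) (auto intro: arg_cong[of _ _ card])
  finally have "card J * d = wdeg ?w (gsubst \<theta> (block_det k V J))"
    by (simp add: card_cartesian_product)
  also have "\<dots> \<le> wdeg ?w (block_det k V J)"
    by (rule wdeg_gsubst_le) (auto simp: \<theta>_def)
  finally show ?thesis .
qed

text \<open>The factors are compared after specialization to the generic block, where degrees in the
  rows and columns of the block are under control. The conclusion survives the return to
  \<open>a\<close> and \<open>b\<close> because restriction to \<open>V\<close> does not see the
  specialization.\<close>

lemma restricted_factor_free: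
  assumes units: "\<And>\<alpha> \<beta>. \<alpha> < d \<Longrightarrow> \<beta> < d \<Longrightarrow> realizes q k (unit_mat \<alpha> \<beta>)"
    and V: "finite V" "J \<subseteq> V"
    and G: "finite G" "V \<inter> G = {}" "card G = q * (card J * d)\<^sup>2"
    and ab: "gdet (V \<union> G) = a * b"
  shows "wdeg (touch J) (grestrict (vars V) a) = 0 \<or> wdeg (touch J) (grestrict (vars V) b) = 0"
proof -
  obtain \<theta> where \<theta>: "gsubst \<theta> (gdet (V \<union> G)) = block_det k V J"
    "\<And>p. grestrict (vars V) (gsubst \<theta> p) = grestrict (vars V) p"
    using block_specialization[OF units V G] by blast
  let ?U = "J \<times> {..<d}" and ?P = "block_det k V J"
  let ?row = "\<lambda>\<rho> v. of_bool (v \<in> block_var g ` ({\<rho>} \<times> ?U)) :: nat"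
  let ?col = "\<lambda>\<sigma> v. of_bool (v \<in> block_var g ` (?U \<times> {\<sigma>})) :: nat"
  let ?Z = "\<lambda>v. of_bool (v \<in> block_var g ` (?U \<times> ?U)) :: nat"
  let ?one = "\<lambda>e v. of_bool (v = block_var g e) :: nat"
  have UV: "?U \<subseteq> V \<times> {..<d}" using V by auto
  have finV: "finite (V \<times> {..<d})" using V by auto
  have ne: "block_var g e \<noteq> (j, r, c)" if "j \<le> g" for e j r c
    using block_var_fst[of g e] that by auto
  note ne = ne ne[symmetric]
  \<comment> \<open>The restriction of \<open>?P\<close> is \<open>gdet V\<close>, which has
    constant term 1. Once \<open>?P\<close> is nonzero, degrees of its factors add.\<close>
  have "grestrict (vars V) ?P \<noteq> 0"
    using \<theta>(2)[of "gdet (V \<union> G)"] grestrict_gdet[of "V \<union> G" V] gdet_nonzero[of V] V G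
    by (simp add: \<theta>(1))
  then have P0: "?P \<noteq> 0" by auto
  have row: "wdeg (?row \<rho>) ?P \<le> 1" for \<rho>
  proof -
    have "wdeg (?row \<rho>) ?P \<le> (\<Sum>i\<in>V \<times> {..<d}. of_bool (i = \<rho>)) + (\<Sum>i\<in>V \<times> {..<d}. 0)"
      using V by (intro wdeg_block_det_le) (auto simp: ne)
    then show ?thesis using finV by (auto simp: of_bool_def split: if_splits)
  qed
  have col: "wdeg (?col \<sigma>) ?P \<le> 1" for \<sigma>
  proof -
    have "wdeg (?col \<sigma>) ?P \<le> (\<Sum>i\<in>V \<times> {..<d}. 0) + (\<Sum>i\<in>V \<times> {..<d}. of_bool (i = \<sigma>))"
      using V by (intro wdeg_block_det_le) (auto simp: ne)
    then show ?thesis using finV by (auto simp: of_bool_def split: if_splits)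
  qed
  \<comment> \<open>With these weights the block part of the factor containing the block already attains
    the bound on the degree of the whole determinant.\<close>
  define w where "w v = (if fst v < g then touch J v else if fst v = g then 0 else 2)" for v
  have wP: "wdeg w ?P \<le> 2 * (card J * d)"
  proof -
    have "wdeg w ?P \<le> (\<Sum>i\<in>V \<times> {..<d}. of_bool (i \<in> ?U)) + (\<Sum>i\<in>V \<times> {..<d}. of_bool (i \<in> ?U))"
      using V block_var_fst[of g] by (intro wdeg_block_det_le) (auto simp: w_def touch_def)
    also have "(\<Sum>i\<in>V \<times> {..<d}. of_bool (i \<in> ?U)) = card ?U"
      using V by (subst sum_of_bool_eq) (auto intro: arg_cong[of _ _ card])
    finally show ?thesis by (simp add: card_cartesian_product)
  qed
  have free: "wdeg (touch J) (grestrict (vars V) y) = 0"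
    if xy: "gdet (V \<union> G) = x * y" and y: "wdeg ?Z (gsubst \<theta> y) = 0" for x y
  proof -
    have P: "?P = gsubst \<theta> x * gsubst \<theta> y"
      using \<theta>(1) xy by (simp add: gsubst.hom_mult)
    then have nz: "gsubst \<theta> x \<noteq> 0" "gsubst \<theta> y \<noteq> 0" using P0 by auto
    \<comment> \<open>As \<open>y\<close> specializes to a polynomial without block variables, the
      whole block degree falls to the specialization of \<open>x\<close>.\<close>
    have "card J * d \<le> wdeg ?Z (gsubst \<theta> x)"
      using block_det_block_degree[OF V, of k] y unfolding P wdeg_mult[OF nz] by simp
    moreover have "2 * ?Z v \<le> w v" for v
    proof (cases "v \<in> block_var g ` (?U \<times> ?U)")
      case True
      then obtain e where "v = block_var g e" by blast
      then show ?thesis using block_var_fst[of g e] by (simp add: w_def)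
    qed simp
    then have "2 * wdeg ?Z (gsubst \<theta> x) \<le> wdeg w (gsubst \<theta> x)"
      by (rule wdeg_scale_le)
    moreover have "wdeg w (gsubst \<theta> x) + wdeg w (gsubst \<theta> y) \<le> 2 * (card J * d)"
      using wP unfolding P wdeg_mult[OF nz] .
    ultimately have "wdeg w (gsubst \<theta> y) = 0" by linarith
    \<comment> \<open>On \<open>vars V\<close> the weights \<open>w\<close> and
      \<open>touch J\<close> agree, and the remaining variables are deleted.\<close>
    moreover have "wdeg (touch J) (grestrict (vars V) (gsubst \<theta> y)) \<le> wdeg w (gsubst \<theta> y)"
      unfolding grestrict_def by (rule wdeg_gsubst_le) (auto simp: w_def vars_def)
    ultimately show ?thesis by (simp add: \<theta>(2))
  qed
  have P: "?P = gsubst \<theta> a * gsubst \<theta> b"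
    using \<theta>(1) ab by (simp add: gsubst.hom_mult)
  then have nz: "gsubst \<theta> a \<noteq> 0" "gsubst \<theta> b \<noteq> 0" using P0 by auto
  have occurs: "\<exists>\<rho>\<in>?U. \<exists>\<sigma>\<in>?U. wdeg (?row \<rho>) p \<ge> 1 \<and> wdeg (?col \<sigma>) p \<ge> 1"
    if "wdeg ?Z p \<noteq> 0" for p :: "'k gpoly"
  proof -
    have "\<exists>m\<in>keys p. \<exists>v\<in>keys m. ?Z v \<noteq> 0"
      using that unfolding wdeg_eq_0_iff by blast
    then obtain m v where mv: "m \<in> keys p" "v \<in> keys m" "?Z v \<noteq> 0"
      by blast
    then have "v \<in> block_var g ` (?U \<times> ?U)" by (simp only: of_bool_eq_0_iff not_not)
    then obtain \<rho> \<sigma> where e: "\<rho> \<in> ?U" "\<sigma> \<in> ?U" "v = block_var g (\<rho>, \<sigma>)" by blast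
    then have "?row \<rho> v \<noteq> 0" "?col \<sigma> v \<noteq> 0" by auto
    then have "wdeg (?row \<rho>) p \<ge> 1" "wdeg (?col \<sigma>) p \<ge> 1"
      using wdeg_pos[OF mv(1,2)] by (simp_all only: not_False_eq_True)
    then show ?thesis using e(1,2) by blast
  qed
  \<comment> \<open>Suppose that both factors contain block variables, \<open>a\<close> one in row
    \<open>\<rho>\<close> and \<open>b\<close> one in column \<open>\<sigma>\<close>. By linearity
    \<open>b\<close> has none in row \<open>\<rho>\<close> and \<open>a\<close> none in column
    \<open>\<sigma>\<close>, so neither contains the variable at \<open>(\<rho>, \<sigma>)\<close>,
    although it occurs in the product.\<close>
  have "wdeg ?Z (gsubst \<theta> a) = 0 \<or> wdeg ?Z (gsubst \<theta> b) = 0"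
  proof (rule ccontr)
    assume "\<not> ?thesis"
    then obtain \<rho> \<sigma> where *: "\<rho> \<in> ?U" "\<sigma> \<in> ?U"
      "wdeg (?row \<rho>) (gsubst \<theta> a) \<ge> 1" "wdeg (?col \<sigma>) (gsubst \<theta> b) \<ge> 1"
      using occurs[of "gsubst \<theta> a"] occurs[of "gsubst \<theta> b"] by blast
    have "wdeg (?row \<rho>) (gsubst \<theta> b) = 0" "wdeg (?col \<sigma>) (gsubst \<theta> a) = 0"
      using row[of \<rho>] col[of \<sigma>] *(3,4) unfolding P wdeg_mult[OF nz] by linarith+
    moreover have "wdeg (?one (\<rho>, \<sigma>)) p \<le> wdeg (?row \<rho>) p" "wdeg (?one (\<rho>, \<sigma>)) p \<le> wdeg (?col \<sigma>) p"
      for p :: "'k gpoly"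
      using * by (intro wdeg_mono; auto)+
    ultimately have "wdeg (?one (\<rho>, \<sigma>)) ?P = 0"
      unfolding P wdeg_mult[OF nz] by (metis add_0 le_zero_eq)
    then show False using block_det_entry_occurs[OF V *(1,2), of k] by simp
  qed
  then show ?thesis
    using free[of a b] free[of b a] ab by (auto simp: mult.commute)
qed

end

section \<open>Irreducibility for large sizes\<close>

lemma mono_eq_0_iff: "m = 0 \<longleftrightarrow> keys m = {}"
proof
  assume "keys m = {}"
  then have "lookup m v = 0" for v
    using not_in_keys_iff_lookup_eq_zero[of v m] by simp
  then show "m = 0" by (intro poly_mapping_eqI) simp
qed simp

lemma constant_iff_wdeg: "keys p \<subseteq> {0} \<longleftrightarrow> wdeg (\<lambda>_. 1) p = 0"
proof -
  have "(\<forall>v\<in>keys m. (1::nat) = 0) \<longleftrightarrow> m = 0" for m :: "gindex \<Rightarrow>\<^sub>0 nat"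
    unfolding mono_eq_0_iff by (simp only: one_neq_zero) blast
  then show ?thesis unfolding wdeg_eq_0_iff by blast
qed

lemma constant_grestrict: "keys p \<subseteq> {0} \<Longrightarrow> keys (grestrict T p) \<subseteq> {0}"
  by (auto simp: keys_grestrict)

lemma constantE:
  assumes "keys p \<subseteq> {0}"
  obtains c where "p = gconst c"
proof -
  have "\<exists>c. p = gconst c" unfolding gpoly_const_iff by (rule assms)
  then show ?thesis using that by blast
qed

lemma constant_mult:
  fixes p q :: "'k::field gpoly"
  assumes "keys p \<subseteq> {0}" "keys q \<subseteq> {0}"
  shows "keys (p * q) \<subseteq> {0}"
proof -
  obtain c c' where "p = gconst c" "q = gconst c'"
    using constantE[OF assms(1)] constantE[OF assms(2)] by metis
  then have "p * q = gconst (c * c')" by (simp only: gconst_mult)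
  then show ?thesis using gpoly_const_iff by blast
qed

text \<open>Fekete's argument: \<open>r m / m\<close> comes arbitrarily close to its supremum
  \<open>\<rho>\<close> for all large \<open>m\<close>. So \<open>r (m + C) - r m\<close> is at most
  a constant plus a small multiple of \<open>m\<close>.\<close>

lemma superadditive_gap:
  fixes r :: "nat \<Rightarrow> nat"
  assumes super: "\<And>m n. r m + r n \<le> r (m + n)" and bound: "\<And>n. r n \<le> d * n"
  shows "\<exists>N. \<forall>m\<ge>N. 2 * r (m + C) \<le> 2 * r m + m"
proof -
  let ?S = "(\<lambda>k. real (r k) / real k) ` {1..}"
  define \<rho> where "\<rho> = Sup ?S"
  have le_d: "real (r k) / real k \<le> d" if "k \<ge> 1" for k
    using bound[of k] that by (simp add: divide_le_eq flip: of_nat_mult)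
  have bdd: "bdd_above ?S"
    using le_d by (intro bdd_aboveI[of _ "real d"]) auto
  have upper: "real (r n) \<le> \<rho> * n" if "n \<ge> 1" for n
  proof -
    have "real (r n) / real n \<le> \<rho>"
      unfolding \<rho>_def using that by (intro cSup_upper bdd) auto
    then show ?thesis using that by (simp add: divide_le_eq)
  qed
  have "\<rho> - 1/8 < Sup ?S" by (simp add: \<rho>_def)
  then obtain k where k: "k \<ge> 1" "\<rho> - 1/8 < real (r k) / real k"
    using less_cSup_iff[of ?S "\<rho> - 1/8"] bdd by auto
  have \<rho>d: "\<rho> \<le> d" unfolding \<rho>_def using le_d by (intro cSup_least) auto
  have mult: "q * r k + r t \<le> r (q * k + t)" for q t
  proof (induction q)
    case (Suc q)
    then show ?case using super[of k "q * k + t"] by (simp add: add.assoc)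
  qed simp
  show ?thesis
  proof (intro exI allI impI)
    \<comment> \<open>The threshold bounds \<open>\<rho> * (C + k)\<close> by \<open>m / 3\<close>.
      Together with the error \<open>(m - k) / 8\<close> from the choice of \<open>k\<close> this
      stays below \<open>m / 2\<close>.\<close>
    fix m assume m: "m \<ge> 3 * d * (C + k) + k + 1"
    let ?x = "real (r k) / real k"
    have "(m div k) * r k \<le> r m"
      using mult[of "m div k" "m mod k"] by simp
    then have "real (m div k) * real (r k) \<le> real (r m)"
      by (metis of_nat_le_iff of_nat_mult)
    moreover have "real (m div k) * real k * ?x = real (m div k) * real (r k)" using k(1) by simp
    ultimately have 1: "real (m div k) * real k * ?x \<le> real (r m)"
      by linarith
    have "m \<le> m div k * k + k"
      using k(1) mod_less_divisor[of k m] div_mult_mod_eq[of m k] by linarith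
    then have "real m \<le> real (m div k * k + k)"
      by (simp only: of_nat_le_iff)
    then have "real m - real k \<le> real (m div k) * real k"
      by simp
    then have "(real m - real k) * ?x \<le> real (r m)"
      using 1 by (intro order.trans[OF mult_right_mono 1]) auto
    moreover have "(real m - real k) * (\<rho> - 1/8) \<le> (real m - real k) * ?x"
      using k(2) m by (intro mult_left_mono) auto
    ultimately have 2: "(real m - real k) * (\<rho> - 1/8) \<le> real (r m)" by linarith
    have 3: "real (r (m + C)) \<le> \<rho> * (real m + real C)"
      using upper[of "m + C"] m by simp
    have "\<rho> * (real C + real k) \<le> real d * (real C + real k)"
      using \<rho>d by (intro mult_right_mono) auto
    moreover have "3 * (real d * (real C + real k)) \<le> real m"
    proof -
      have "real (3 * d * (C + k)) \<le> real m" using m by linarith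
      then show ?thesis by (simp add: algebra_simps)
    qed
    moreover have "\<rho> * (real m + real C) - (real m - real k) * (\<rho> - 1/8)
        = \<rho> * (real C + real k) + (real m - real k) / 8"
      by (simp add: algebra_simps)
    moreover have "2 * a \<le> 2 * b + c"
      if "x \<le> y" "3 * y \<le> c" "u - v = x + (c - e) / 8" "v \<le> b" "a \<le> u" "0 \<le> e" "0 \<le> c"
      for a b c e u v x y :: real
      using that by (simp add: field_simps)
    ultimately have "2 * real (r (m + C)) \<le> 2 * real (r m) + real m"
      using 2 3 by (meson of_nat_0_le_iff)
    then show "2 * r (m + C) \<le> 2 * r m + m" by linarith
  qed
qed

section \<open>Growth of the degree with the number of nodes\<close>

context pencil
begin

lemma gdet_keys:
  assumes "finite V" "m \<in> keys (gdet V)"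
  shows "keys m \<subseteq> vars V"
proof -
  have "grestrict (vars V) (gdet V) = gdet V" using grestrict_gdet[OF assms(1), of V] by simp
  then show ?thesis using assms(2) keys_grestrict[of "vars V" "gdet V"] by auto
qed

text \<open>Deleting all edges between \<open>V\<close> and \<open>W\<close> makes the determinant
  split into a product.\<close>

lemma gdet_union:
  assumes fin: "finite V" "finite W" and disj: "V \<inter> W = {}"
  shows "wdeg (\<lambda>_. 1) (gdet V) + wdeg (\<lambda>_. 1) (gdet W) \<le> wdeg (\<lambda>_. 1) (gdet (V \<union> W))"
proof -
  let ?\<theta> = "\<lambda>(j, r, c). if r \<in> V \<longleftrightarrow> c \<in> V then gvar (j, r, c) else (0 :: 'k gpoly)"
  let ?B = "\<lambda>\<rho> \<sigma>. if fst \<rho> \<in> V \<longleftrightarrow> fst \<sigma> \<in> V then lin (gen_tuple (V \<union> W)) \<rho> \<sigma> else 0"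
  have "gsubst ?\<theta> (gdet (V \<union> W)) = pdet (V \<union> W) ?B"
    unfolding gdet_def gsubst_pdet gsubst_lin
    by (intro pdet_cong) (auto simp: lin_def gen_tuple_def intro!: sum.cong sum.neutral)
  also have "\<dots> = pdet V ?B * pdet W ?B"
    unfolding pdet_def Times_Un_distrib1 using fin disj by (intro fdet_block_triangular) auto
  also have "pdet V ?B = gdet V"
    unfolding gdet_def by (intro pdet_cong) (auto simp: lin_def gen_tuple_def)
  also have "pdet W ?B = gdet W"
    unfolding gdet_def using disj by (intro pdet_cong) (auto simp: lin_def gen_tuple_def)
  finally have "wdeg (\<lambda>_. 1) (gsubst ?\<theta> (gdet (V \<union> W))) = wdeg (\<lambda>_. 1) (gdet V) + wdeg (\<lambda>_. 1) (gdet W)"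
    using gdet_nonzero[OF fin(1)] gdet_nonzero[OF fin(2)] by (simp add: wdeg_mult)
  moreover have "wdeg (\<lambda>_. 1) (gsubst ?\<theta> (gdet (V \<union> W))) \<le> wdeg (\<lambda>_. 1) (gdet (V \<union> W))"
    by (rule wdeg_gsubst_le) auto
  ultimately show ?thesis by simp
qed

lemma gdet_shift: "wdeg (\<lambda>_. 1) (gdet {..<n}) \<le> wdeg (\<lambda>_. 1) (gdet {m..<m + n})"
proof -
  \<comment> \<open>Truncated subtraction is exact here, since only nodes from \<open>m\<close> on
    occur in the determinant.\<close>
  let ?\<theta> = "\<lambda>(j, r, c). gvar (j, r - m, c - m) :: 'k gpoly"
  let ?f = "\<lambda>\<rho> :: nat \<times> nat. (fst \<rho> + m, snd \<rho>)"
  have f: "bij_betw ?f ({..<n} \<times> {..<d}) ({m..<m + n} \<times> {..<d})"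
    by (rule bij_betw_byWitness[of _ "\<lambda>\<rho>. (fst \<rho> - m, snd \<rho>)"]) auto
  have "gsubst ?\<theta> (gdet {m..<m + n})
      = pdet {m..<m + n} (lin (\<lambda>j r c. gvar (j, r - m, c - m)))"
    unfolding gdet_def gsubst_pdet gsubst_lin
    by (intro pdet_cong lin_cong) (auto simp: gen_tuple_def)
  also have "\<dots> = gdet {..<n}"
    unfolding pdet_def gdet_def by (subst fdet_reindex[OF f])
      (auto intro!: fdet_cong simp: lin_def gen_tuple_def prod_eq_iff)
  finally have "gsubst ?\<theta> (gdet {m..<m + n}) = gdet {..<n}" .
  moreover have "wdeg (\<lambda>_. 1) (gsubst ?\<theta> (gdet {m..<m + n})) \<le> wdeg (\<lambda>_. 1) (gdet {m..<m + n})"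
    by (rule wdeg_gsubst_le) auto
  ultimately show ?thesis by simp
qed

lemma gdet_degree_superadditive:
  "wdeg (\<lambda>_. 1) (gdet {..<m}) + wdeg (\<lambda>_. 1) (gdet {..<n}) \<le> wdeg (\<lambda>_. 1) (gdet {..<m + n})"
proof -
  have "{..<m} \<union> {m..<m + n} = {..<m + n}" by auto
  moreover have "{..<m} \<inter> {m..<m + n} = {}" by auto
  ultimately show ?thesis
    using gdet_union[of "{..<m}" "{m..<m + n}"] gdet_shift[of n m] by simp
qed

lemma gdet_degree_le: "wdeg (\<lambda>_. 1) (gdet {..<n}) \<le> d * n"
proof -
  have "wdeg (\<lambda>_. 1) (gdet {..<n}) \<le> (\<Sum>i\<in>{..<n} \<times> {..<d}. 1) + (\<Sum>i\<in>{..<n} \<times> {..<d}. 0)"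
    unfolding gdet_def pdet_def
  proof (intro wdeg_fdet_le wdeg_diff_le)
    fix \<rho> \<sigma>
    have "wdeg (\<lambda>_. 1) (gconst c * gen_tuple {..<n} j r s) \<le> 1" for c j r s
      using wdeg_mult_le[of "\<lambda>_. 1" "gconst c" "gen_tuple {..<n} j r s"] by (cases "r < n \<and> s < n") (auto simp: gen_tuple_def)
    then show "wdeg (\<lambda>_. 1) (lin (gen_tuple {..<n}) \<rho> \<sigma>) \<le> 1 + 0"
      unfolding lin_def by (intro wdeg_sum_le) simp
  qed auto
  then show ?thesis by (simp add: card_cartesian_product mult.commute)
qed

end

section \<open>Factors of the generic determinant are constant\<close>

locale irreducible_pencil_units = pencil A d g
  for A :: "nat \<Rightarrow> 'k::field mat" and d g +
  fixes q k :: nat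
  assumes d_pos: "d \<ge> 1"
    and units: "\<And>\<alpha> \<beta>. \<alpha> < d \<Longrightarrow> \<beta> < d \<Longrightarrow> realizes q k (unit_mat \<alpha> \<beta>)"
begin

text \<open>There are enough nodes to produce a generic block at a single node \<open>i\<close>. A
  constant would stay constant under this specialization, whereas \<open>block_det\<close> involves
  the entries of the block.\<close>

lemma gdet_nonconstant:
  assumes W: "finite W" "card W \<ge> 1 + q * d\<^sup>2"
  shows "\<not> keys (gdet W) \<subseteq> {0}"
proof
  assume "keys (gdet W) \<subseteq> {0}"
  then obtain c where c: "gdet W = gconst c" by (rule constantE)
  obtain V G where VG: "W = V \<union> G" "V \<inter> G = {}" "card G = q * d\<^sup>2" "finite V" "finite G" "card V = card W - q * d\<^sup>2"
  proof (rule split_card[of W "card W - q * d\<^sup>2" "q * d\<^sup>2"])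
    show "card W = card W - q * d\<^sup>2 + q * d\<^sup>2" using W by simp
  qed (use W in auto)
  have "card V > 0" using VG(6) W(2) by linarith
  then have "V \<noteq> {}" by auto
  then obtain i where i: "i \<in> V" by blast
  obtain \<theta> where "gsubst \<theta> (gdet (V \<union> G)) = block_det k V {i}"
    by (rule block_specialization[OF units, of V "{i}" G]) (use VG(2-5) i in auto)
  then have "block_det k V {i} = gconst c" using c VG(1) by simp
  moreover have "wdeg (\<lambda>v. of_bool (v = block_var g ((i, 0), (i, 0)))) (block_det k V {i}) \<ge> 1"
    using VG(4) i d_pos by (intro block_det_entry_occurs) auto
  ultimately show False by simp
qed

text \<open>Blocks at pairs of nodes force the same factor to avoid both nodes of each pair; single
  nodes would leave the choice of the factor dependent on the node.\<close>

lemma restricted_factor_constant: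
  assumes V: "finite V" "card V \<ge> 2" and G: "finite G" "V \<inter> G = {}" "card G = q * (2 * d)\<^sup>2"
    and ab: "gdet (V \<union> G) = a * b"
  shows "keys (grestrict (vars V) a) \<subseteq> {0} \<or> keys (grestrict (vars V) b) \<subseteq> {0}"
proof -
  have const: "keys (grestrict (vars V) p) \<subseteq> {0}"
    if free: "\<forall>i\<in>V. wdeg (touch {i}) (grestrict (vars V) p) = 0" for p :: "'k gpoly"
  proof -
    have "keys m = {}" if m: "m \<in> keys (grestrict (vars V) p)" for m
    proof (rule ccontr)
      assume "keys m \<noteq> {}"
      then obtain j r c where v: "(j, r, c) \<in> keys m" by (metis all_not_in_conv prod_cases3)
      then have "r \<in> V" using m by (auto simp: keys_grestrict vars_def)
      then have "wdeg (touch {r}) (grestrict (vars V) p) = 0"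
        using free by simp
      moreover have "touch {r} (j, r, c) \<noteq> 0" by (simp add: touch_def)
      then have "wdeg (touch {r}) (grestrict (vars V) p) \<ge> 1" by (rule wdeg_pos[OF m v])
      ultimately show False by linarith
    qed
    then show ?thesis unfolding mono_eq_0_iff[symmetric] by blast
  qed
  let ?I = "\<lambda>p i. wdeg (touch {i}) (grestrict (vars V) p) = 0"
  have pair: "(?I a i \<and> ?I a l) \<or> (?I b i \<and> ?I b l)" if "i \<in> V" "l \<in> V" "i \<noteq> l" for i l
  proof -
    have mono: "?I p i \<and> ?I p l" if "wdeg (touch {i, l}) (grestrict (vars V) p) = 0" for p
    proof -
      have "wdeg (touch {i'}) (grestrict (vars V) p) \<le> wdeg (touch {i, l}) (grestrict (vars V) p)"
        if "i' \<in> {i, l}" for i'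
        by (rule wdeg_mono) (use that in \<open>auto simp: touch_def\<close>)
      from this[of i] this[of l] show ?thesis using that by simp
    qed
    have "card {i, l} = 2" using that(3) by simp
    then have "card G = q * (card {i, l} * d)\<^sup>2" using G(3) by (simp only:)
    then have "wdeg (touch {i, l}) (grestrict (vars V) a) = 0 \<or> wdeg (touch {i, l}) (grestrict (vars V) b) = 0"
      by (intro restricted_factor_free[OF units V(1) _ G(1,2) _ ab]) (use that in auto)
    then show ?thesis using mono by blast
  qed
  have "(\<forall>i\<in>V. ?I a i) \<or> (\<forall>i\<in>V. ?I b i)"
  proof (rule ccontr)
    assume "\<not> ?thesis"
    then obtain i l where il: "i \<in> V" "\<not> ?I a i" "l \<in> V" "\<not> ?I b l" by blast
    \<comment> \<open>The pair \<open>i, l\<close> gives a contradiction if the nodes differ. If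
      they coincide, both factors involve \<open>i\<close>, and any other node \<open>m\<close>
      serves as partner.\<close>
    have "V \<noteq> {i}" using V(2) by auto
    then obtain m where "m \<in> V" "m \<noteq> i" using il(1) by blast
    then show False using pair[of i l] pair[of i m] il by metis
  qed
  then show ?thesis using const by blast
qed

text \<open>Constancy of \<open>b\<close> on one complement spreads to every complement of
  \<open>?C\<close> nodes. The degree bound then ensures that each monomial of \<open>b\<close>
  lives on such a complement.\<close>

lemma factor_constant:
  assumes n: "n \<ge> 2 * (q * (2 * d)\<^sup>2) + q * d\<^sup>2 + 2"
    and gap: "2 * wdeg (\<lambda>_. 1) (gdet {..<n}) \<le> 2 * wdeg (\<lambda>_. 1) (gdet {..<n - q * (2 * d)\<^sup>2}) + (n - q * (2 * d)\<^sup>2)"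
    and ab: "gdet {..<n} = a * b"
    and b0: "keys (grestrict (vars {..<n - q * (2 * d)\<^sup>2}) b) \<subseteq> {0}"
  shows "keys b \<subseteq> {0}"
proof -
  let ?C = "q * (2 * d)\<^sup>2"
  let ?U = "{..<n - ?C}"
  have ne: "gdet {..<n} \<noteq> 0" by (rule gdet_nonzero) simp
  have ab0: "a \<noteq> 0" "b \<noteq> 0" using ne ab by auto
  have restrict_b: "keys (grestrict (vars ({..<n} - G)) b) \<subseteq> {0}" if G: "G \<subseteq> {..<n}" "card G = ?C" for G
  proof -
    let ?V = "{..<n} - G"
    have fG: "finite G" using G finite_subset by blast
    have cV: "card ?V = n - ?C" using G fG by (simp add: card_Diff_subset)
    have "?V \<union> G = {..<n}" using G by auto
    then consider "keys (grestrict (vars ?V) a) \<subseteq> {0}" | "keys (grestrict (vars ?V) b) \<subseteq> {0}"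
      using restricted_factor_constant[of ?V G a b] fG G cV n ab by force
    then show ?thesis
    proof cases
      case 1
      \<comment> \<open>If \<open>a\<close> were the constant factor on \<open>?V\<close>, then on
        the overlap both factors, and hence \<open>gdet ?W\<close>, would be constant. The overlap
        misses at most \<open>2 * ?C\<close> nodes, so it is too large for that.\<close>
      let ?W = "?U \<inter> ?V"
      have vW: "vars ?W = vars ?W \<inter> vars ?V" "vars ?W = vars ?W \<inter> vars ?U" by (auto simp: vars_def)
      have "keys (grestrict (vars ?W) a) \<subseteq> {0}"
        using constant_grestrict[OF 1, of "vars ?W"] unfolding grestrict_grestrict vW(1)[symmetric] .
      moreover have "keys (grestrict (vars ?W) b) \<subseteq> {0}"
        using constant_grestrict[OF b0, of "vars ?W"] unfolding grestrict_grestrict vW(2)[symmetric] .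
      moreover have "gdet ?W = grestrict (vars ?W) a * grestrict (vars ?W) b"
      proof -
        have "?W \<subseteq> {..<n}" by blast
        then have "grestrict (vars ?W) (gdet {..<n}) = gdet ?W" by (intro grestrict_gdet) simp_all
        then show ?thesis unfolding ab grestrict.hom_mult by (rule sym)
      qed
      ultimately have "keys (gdet ?W) \<subseteq> {0}"
        by (simp only: constant_mult)
      moreover have "card ?W \<ge> 1 + q * d\<^sup>2"
      proof -
        have "?W = {..<n} - ({n - ?C..<n} \<union> G)" by auto
        moreover have "card ({..<n} - ({n - ?C..<n} \<union> G)) = card {..<n} - card ({n - ?C..<n} \<union> G)"
        proof (rule card_Diff_subset)
          show "{n - ?C..<n} \<union> G \<subseteq> {..<n}" using G(1) by auto
        qed (use fG in simp)
        ultimately have "card ?W = n - card ({n - ?C..<n} \<union> G)" by (simp only: card_lessThan)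
        moreover have "card ({n - ?C..<n} \<union> G) \<le> ?C + ?C"
          using card_Un_le[of "{n - ?C..<n}" G] unfolding G(2) card_atLeastLessThan by linarith
        ultimately show ?thesis using n by linarith
      qed
      ultimately show ?thesis using gdet_nonconstant[of ?W] by blast
    qed
  qed
  \<comment> \<open>On \<open>?U\<close> the factor \<open>b\<close> is constant, so
    \<open>a\<close> already has at least the degree of \<open>gdet ?U\<close>. Only the gap between
    the two determinants is left for \<open>b\<close>.\<close>
  have deg: "2 * wdeg (\<lambda>_. 1) b \<le> n - ?C"
  proof -
    have "grestrict (vars ?U) (gdet {..<n}) = gdet ?U" by (intro grestrict_gdet) auto
    then have f: "gdet ?U = grestrict (vars ?U) a * grestrict (vars ?U) b"
      unfolding ab grestrict.hom_mult by (rule sym)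
    have "gdet ?U \<noteq> 0" by (rule gdet_nonzero) simp
    then have "grestrict (vars ?U) a \<noteq> 0" "grestrict (vars ?U) b \<noteq> 0" unfolding f by auto
    from wdeg_mult[OF this, of "\<lambda>_. 1"]
    have "wdeg (\<lambda>_. 1) (gdet ?U) = wdeg (\<lambda>_. 1) (grestrict (vars ?U) a)"
      using b0 unfolding constant_iff_wdeg f by linarith
    also have "\<dots> \<le> wdeg (\<lambda>_. 1) a" by (rule wdeg_grestrict_le)
    finally show ?thesis
      using gap wdeg_mult[OF ab0, of "\<lambda>_. 1"] unfolding ab by linarith
  qed
  show ?thesis
  proof
    fix m assume m: "m \<in> keys b"
    \<comment> \<open>A factor involves no variables beyond those of the product, by additivity of
      the degree in the foreign variables.\<close>
    have "wdeg (\<lambda>v. of_bool (v \<notin> vars {..<n})) (gdet {..<n}) = 0"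
      using gdet_keys[of "{..<n}"] by (auto simp: wdeg_eq_0_iff)
    then have "wdeg (\<lambda>v. of_bool (v \<notin> vars {..<n})) b = 0"
      using wdeg_mult[OF ab0] ab by simp
    then have mv: "keys m \<subseteq> vars {..<n}"
      using m unfolding wdeg_eq_0_iff by auto
    \<comment> \<open>The nodes met by \<open>m\<close>: at most two for each variable, hence at
      most twice the degree of \<open>b\<close>.\<close>
    define I where "I = (\<lambda>v. fst (snd v)) ` keys m \<union> (\<lambda>v. snd (snd v)) ` keys m"
    have I: "I \<subseteq> {..<n}" using mv by (auto simp: I_def vars_def)
    have "card (keys m) \<le> mono_wt (\<lambda>_. 1) m"
      unfolding mono_wt_def card_eq_sum by (intro sum_mono) (auto simp: in_keys_iff)
    also have "\<dots> \<le> wdeg (\<lambda>_. 1) b" by (rule mono_wt_le_wdeg[OF m])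
    finally have "card I \<le> 2 * wdeg (\<lambda>_. 1) b"
      unfolding I_def
      using card_Un_le[of "(\<lambda>v. fst (snd v)) ` keys m" "(\<lambda>v. snd (snd v)) ` keys m"]
        card_image_le[of "keys m" "\<lambda>v. fst (snd v)"] card_image_le[of "keys m" "\<lambda>v. snd (snd v)"]
      by simp
    then have "card I \<le> n - ?C" using deg by linarith
    moreover have "card ({..<n} - I) = n - card I"
      using I finite_subset[OF I] by (simp add: card_Diff_subset)
    ultimately have "?C \<le> card ({..<n} - I)" using n by linarith
    \<comment> \<open>Removing \<open>G\<close> from the nodes keeps \<open>m\<close> as a monomial
      of the restriction of \<open>b\<close>. That restriction is constant, so
      \<open>m = 0\<close>.\<close>
    then obtain G where G: "G \<subseteq> {..<n} - I" "card G = ?C"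
      by (rule obtain_subset_with_card_n)
    have "keys m \<subseteq> vars ({..<n} - G)"
    proof
      fix v assume v: "v \<in> keys m"
      then have "fst (snd v) \<in> I" "snd (snd v) \<in> I" unfolding I_def by blast+
      moreover have "v \<in> vars {..<n}" using v mv by blast
      ultimately show "v \<in> vars ({..<n} - G)"
        using G(1) unfolding vars_def mem_Times_iff by blast
    qed
    then have "m \<in> keys (grestrict (vars ({..<n} - G)) b)"
      using m by (simp add: keys_grestrict)
    then show "m \<in> {0}" using restrict_b[of G] G by blast
  qed
qed

lemma gdet_eventually_irreducible: "\<exists>n0. \<forall>n\<ge>n0. irreducible (gdet {..<n})"
proof -
  let ?C = "q * (2 * d)\<^sup>2"
  obtain N where N: "\<And>m. m \<ge> N \<Longrightarrow>
      2 * wdeg (\<lambda>_. 1) (gdet {..<m + ?C}) \<le> 2 * wdeg (\<lambda>_. 1) (gdet {..<m}) + m"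
    using superadditive_gap[of "\<lambda>n. wdeg (\<lambda>_. 1) (gdet {..<n})" d ?C]
      gdet_degree_superadditive gdet_degree_le by blast
  show ?thesis
  proof (intro exI allI impI)
    fix n assume n: "n \<ge> N + (2 * ?C + q * d\<^sup>2 + 2)"
    have gap: "2 * wdeg (\<lambda>_. 1) (gdet {..<n}) \<le> 2 * wdeg (\<lambda>_. 1) (gdet {..<n - ?C}) + (n - ?C)"
      using N[of "n - ?C"] n by simp
    have nonconst: "\<not> keys (gdet {..<n}) \<subseteq> {0}"
      by (rule gdet_nonconstant) (use n in auto)
    have unit: "p dvd 1" if p: "keys p \<subseteq> {0}" "p \<noteq> 0" for p :: "'k gpoly"
    proof -
      obtain c where c: "p = gconst c" by (rule constantE[OF p(1)])
      then have "c \<noteq> 0" using p(2) by auto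
      then have "gconst (c * inverse c) = (1 :: 'k gpoly)" by simp
      then have "1 = p * gconst (inverse c)" by (simp only: c gconst_mult)
      then show ?thesis by (rule dvdI)
    qed
    show "irreducible (gdet {..<n})"
    proof (rule irreducibleI)
      show nz: "gdet {..<n} \<noteq> 0" by (rule gdet_nonzero) simp
      show "\<not> gdet {..<n} dvd 1"
      proof
        assume "gdet {..<n} dvd 1"
        then obtain h where h: "1 = gdet {..<n} * h" by (rule dvdE)
        then have "h \<noteq> 0" by auto
        then have "wdeg (\<lambda>_. 1) (gdet {..<n}) = 0"
          using wdeg_mult[OF nz, of h "\<lambda>_. 1"] h wdeg_1[of "\<lambda>_. 1"] by simp
        then show False using nonconst by (simp add: constant_iff_wdeg)
      qed
      fix a b assume ab: "gdet {..<n} = a * b"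
      \<comment> \<open>One fixed choice of extra nodes decides which factor will turn out to be
        constant.\<close>
      have un: "{..<n - ?C} \<union> {n - ?C..<n} = {..<n}" by auto
      have "keys (grestrict (vars {..<n - ?C}) a) \<subseteq> {0} \<or> keys (grestrict (vars {..<n - ?C}) b) \<subseteq> {0}"
      proof (intro restricted_factor_constant[of _ "{n - ?C..<n}"])
        have "?C \<le> n" using n by linarith
        then show "card {n - ?C..<n} = ?C" unfolding card_atLeastLessThan by (rule diff_diff_cancel)
        show "2 \<le> card {..<n - ?C}" using n unfolding card_lessThan by linarith
        show "gdet ({..<n - ?C} \<union> {n - ?C..<n}) = a * b" unfolding un by (rule ab)
      qed auto
      then have "keys a \<subseteq> {0} \<or> keys b \<subseteq> {0}"
      proof
        have n': "2 * ?C + q * d\<^sup>2 + 2 \<le> n" using n by linarith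
        assume "keys (grestrict (vars {..<n - ?C}) a) \<subseteq> {0}"
        then have "keys a \<subseteq> {0}"
          by (rule factor_constant[OF n' gap ab[unfolded mult.commute[of a b]]])
        then show ?thesis ..
      next
        have n': "2 * ?C + q * d\<^sup>2 + 2 \<le> n" using n by linarith
        assume "keys (grestrict (vars {..<n - ?C}) b) \<subseteq> {0}"
        then have "keys b \<subseteq> {0}" by (rule factor_constant[OF n' gap ab])
        then show ?thesis ..
      qed
      then show "a dvd 1 \<or> b dvd 1" using unit nz ab by auto
    qed
  qed
qed

end

section \<open>Comparison with the Kronecker form of the pencil\<close>

context pencil
begin

text \<open>In the Kronecker product, position \<open>\<alpha>\<close> of the coefficient and node
  \<open>r\<close> have the common index \<open>\<alpha> * n + r\<close>. Renaming rows and columns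
  simultaneously to \<open>(r, \<alpha>)\<close> leaves the determinant unchanged.\<close>

lemma det_pencil_eval: "det (pencil_eval gconst d g A n (generic_mat n)) = gdet {..<n}"
proof (cases "n = 0 \<or> d = 0")
  case True
  \<comment> \<open>Both determinants have an empty index set and equal 1. The reindexing below
    needs \<open>n\<close> to be nonzero for division.\<close>
  then show ?thesis
    by (auto simp: pencil_eval_def gdet_def pdet_def intro!: det_dim_zero minus_carrier_mat)
next
  case False
  let ?f = "\<lambda>i. (i mod n, i div n)"
  have f: "bij_betw ?f {0..<d * n} ({..<n} \<times> {..<d})"
  proof (rule bij_betw_byWitness[of _ "\<lambda>(r, \<alpha>). \<alpha> * n + r"])
    show "(\<lambda>(r, \<alpha>). \<alpha> * n + r) ` ({..<n} \<times> {..<d}) \<subseteq> {0..<d * n}"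
    proof clarsimp
      fix r \<alpha> assume "r < n" "\<alpha> < d"
      then have "\<alpha> * n + r < Suc \<alpha> * n" "Suc \<alpha> * n \<le> d * n"
        by (simp, intro mult_le_mono1) simp
      then show "\<alpha> * n + r < d * n" by linarith
    qed
  qed (use False in \<open>auto simp: less_mult_imp_div_less mult.commute\<close>)
  have lt: "i div n < d" "i mod n < n" if "i < d * n" for i
    using that False by (auto simp: less_mult_imp_div_less)
  have "pencil_eval gconst d g A n (generic_mat n)
    = mat (d * n) (d * n) (\<lambda>(i, j). of_bool (?f i = ?f j) - lin (gen_tuple {..<n}) (?f i) (?f j))"
    (is "?L = ?R")
  proof (rule eq_matI)
    fix i j assume "i < dim_row ?R" "j < dim_col ?R"
    then have ij: "i < d * n" "j < d * n" by auto
    have "i = j \<longleftrightarrow> ?f i = ?f j"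
      using inj_on_eq_iff[OF bij_betw_imp_inj_on[OF f], of i j] ij by simp
    moreover have "(\<Sum>l<g. kronecker (map_mat gconst (A l)) (generic_mat n l) $$ (i, j))
        = lin (gen_tuple {..<n}) (?f i) (?f j)"
      unfolding lin_def
    proof (rule sum.cong)
      fix l assume "l \<in> {..<g}"
      then have "A l \<in> carrier_mat d d" using A_carrier by auto
      then show "kronecker (map_mat gconst (A l)) (generic_mat n l) $$ (i, j)
        = gconst (A l $$ (snd (?f i), snd (?f j))) * gen_tuple {..<n} l (fst (?f i)) (fst (?f j))"
        using ij lt[OF ij(1)] lt[OF ij(2)]
        by (auto simp: kronecker_def generic_mat_def gen_tuple_def)
    qed simp
    ultimately show "?L $$ (i, j) = ?R $$ (i, j)"
      using ij by (simp add: pencil_eval_def)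
  qed (auto simp: pencil_eval_def)
  then show ?thesis
    by (simp add: gdet_def pdet_def fdet_enum[OF f])
qed

end

theorem theorem3:
  fixes A :: "nat \<Rightarrow> 'k :: {alg_closed_field, field_char_0} mat" and d g :: nat
  assumes "d \<ge> 1"
    and "\<And>j. j < g \<Longrightarrow> A j \<in> carrier_mat d d"
    and "irreducible_pencil d g A"
  shows "\<exists>n0. \<forall>n\<ge>n0. irreducible (det (pencil_eval gconst d g A n (generic_mat n)))"
proof -
  interpret pencil A d g by unfold_locales (rule assms(2))
  obtain q k where units: "\<And>\<alpha> \<beta>. \<alpha> < d \<Longrightarrow> \<beta> < d \<Longrightarrow> realizes q k (unit_mat \<alpha> \<beta>)"
    using realizes_units[OF assms(3)] by blast
  interpret irreducible_pencil_units A d g q k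
    by unfold_locales (rule assms(1), rule units)
  show ?thesis
    unfolding det_pencil_eval by (rule gdet_eventually_irreducible)
qed

end
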